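(* Let $P$ be a belt polytope and $\mathcal{F} = \mathcal{F}(P)$. For every cone angle $\alpha$, we have $\widehat{\alpha}, \check{\alpha} \in \mathcal{I}_{\mathsf{L}}(\mathcal{F})$ and \[ \mathsf{L}_\ast \check{\alpha} \ = \ \zeta_{\mathcal{L}_0} \quad \text{ and } \quad \mathsf{L}_\ast \widehat{\alpha}' \ = \ \mu_{\mathcal{L}_0} \, . \]
   Context: A belt polytope $P\subset\R^d$ is a polytope every $2$-face of which has an even number of edges with antipodal edges parallel. A cone angle is a valuation $\alpha$ on polyhedral cones in $\R^d$ with apex at the origin that vanishes on cones of dimension $<d$ and has $\alpha(\R^d)=1$. $\mathcal{F}(P)$ is the face lattice of $P$ (all faces, including $\emptyset$, ordered by inclusion). For faces $\emptyset\neq F\subseteq G$, $\widehat{\alpha}(F,G) = \alpha(\mathrm{cone}(-q+G)+\mathsf{L}(G)^\perp)$ with $q$ in the relative interior of $F$, and $\check{\alpha}(F,G) = \alpha(\mathrm{N}_F G + \mathsf{L}(F))$ with $\mathrm{N}_F G=\{c : \langle c,x\rangle\ge\langle c,y\rangle\ \forall x\in F,y\in G\}$, where $\mathsf{L}(\cdot)$ is the linear subspace parallel to the affine hull; these are extended to the incidence algebra $\mathcal{I}(\mathcal{F})$ by $\widehat{\alpha}(\emptyset,G)=1$ if $\dim G\le 0$ and $0$ otherwise, $\check{\alpha}(\emptyset,G)=1$ for all $G$, and set $\widehat{\alpha}'(F,G) = (-1)^{\dim G-\dim F}\widehat{\alpha}(F,G)$. $\mathcal{L}_0$ is the lattice of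 flats $\{\mathsf{L}(F):\emptyset\ne F\subseteq P\}$ with a new minimum $\emptyset$ adjoined, ordered by inclusion, and $\mathsf{L}(\emptyset)=\emptyset$, so $F\mapsto\mathsf{L}(F)$ is a surjective order- and rank-preserving map $\mathcal{F}\to\mathcal{L}_0$. For a surjective order-preserving map $\phi:\mathcal{P}\to\mathcal{Q}$, $\mathcal{I}_\phi(\mathcal{P})$ is the set of $h\in\mathcal{I}(\mathcal{P})$ such that $\sum_{p\in\phi^{-1}(q)} h(p,p'_1) = \sum_{p\in\phi^{-1}(q)} h(p,p'_2)$ for all $q,q'\in\mathcal{Q}$ and all $p'_1,p'_2\in\phi^{-1}(q')$, and the pushforward is $\phi_\ast h(q,q') = \frac{1}{|\phi^{-1}(q')|}\sum_{p\in\phi^{-1}(q),\,p'\in\phi^{-1}(q')} h(p,p')$. $\zeta$ and $\mu$ denote the zeta and Möbius functions. *)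

theory Defs
  imports "HOL-Analysis.Analysis"
begin

section \<open>Incidence algebras\<close>

text \<open>
  A poset is a carrier set in a type of class \<open>order\<close>. An element of its incidence algebra is a
  total function that vanishes on all pairs that do not span an interval of the carrier.
\<close>

definition incidence_algebra :: "'p::order set \<Rightarrow> ('p \<Rightarrow> 'p \<Rightarrow> real) set" where
  "incidence_algebra Q =
     {h. \<forall>x y. \<not> (x \<in> Q \<and> y \<in> Q \<and> x \<le> y) \<longrightarrow> h x y = 0}"

definition zeta_fun :: "'p::order set \<Rightarrow> 'p \<Rightarrow> 'p \<Rightarrow> real" where
  "zeta_fun Q x y = (if x \<in> Q \<and> y \<in> Q \<and> x \<le> y then 1 else 0)"

function moebius_fun :: "'p::order set \<Rightarrow> 'p \<Rightarrow> 'p \<Rightarrow> real" where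
  "moebius_fun Q x y =
     (if x \<in> Q \<and> y \<in> Q \<and> x \<le> y \<and> finite {z \<in> Q. x \<le> z \<and> z \<le> y}
      then if x = y then 1 else - (\<Sum>z \<in> {z \<in> Q. x \<le> z \<and> z < y}. moebius_fun Q x z)
      else 0)"
  by pat_completeness auto
termination
proof (relation "Wellfounded.measure (\<lambda>(Q, x, y). card {z \<in> Q. x \<le> z \<and> z \<le> y})", goal_cases)
  case (2 Q x y z)
  then have "y \<in> {w \<in> Q. x \<le> w \<and> w \<le> y} - {w \<in> Q. x \<le> w \<and> w \<le> z}"
    and "{w \<in> Q. x \<le> w \<and> w \<le> z} \<subseteq> {w \<in> Q. x \<le> w \<and> w \<le> y}"
    by auto
  then have "{w \<in> Q. x \<le> w \<and> w \<le> z} \<subset> {w \<in> Q. x \<le> w \<and> w \<le> y}"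
    by blast
  with 2 show ?case
    by (simp add: psubset_card_mono)
qed simp

declare moebius_fun.simps [simp del]

text \<open>On a finite poset, \<open>moebius_fun\<close> is the convolution inverse of \<open>zeta_fun\<close>.\<close>

lemma moebius_fun_convolution_zeta_fun:
  assumes "finite Q" "x \<in> Q" "y \<in> Q"
  shows "(\<Sum>z \<in> {z \<in> Q. x \<le> z \<and> z \<le> y}. moebius_fun Q x z * zeta_fun Q z y)
    = (if x = y then 1 else 0)"
proof (cases "x \<le> y")
  case True
  have "(\<Sum>z \<in> {z \<in> Q. x \<le> z \<and> z \<le> y}. moebius_fun Q x z * zeta_fun Q z y)
      = (\<Sum>z \<in> {z \<in> Q. x \<le> z \<and> z \<le> y}. moebius_fun Q x z)"
    using assms by (intro sum.cong) (auto simp: zeta_fun_def)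
  also have "\<dots> = (\<Sum>z \<in> insert y {z \<in> Q. x \<le> z \<and> z < y}. moebius_fun Q x z)"
    using assms True by (intro sum.cong) auto
  also have "(\<Sum>z \<in> insert y {z \<in> Q. x \<le> z \<and> z < y}. moebius_fun Q x z)
      = moebius_fun Q x y + (\<Sum>z \<in> {z \<in> Q. x \<le> z \<and> z < y}. moebius_fun Q x z)"
    using assms by (subst sum.insert) auto
  also have "\<dots> = (if x = y then 1 else 0)"
  proof (cases "x = y")
    case True
    then have "{z \<in> Q. x \<le> z \<and> z < y} = {}" by auto
    moreover have "moebius_fun Q x y = 1"
      using True assms by (subst moebius_fun.simps) simp
    ultimately show ?thesis using True by (simp only: sum.empty simp_thms if_True add_0_right)
  next
    case False
    with assms \<open>x \<le> y\<close> show ?thesis by (subst moebius_fun.simps) simp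
  qed
  finally show ?thesis .
next
  case False
  then have "{z \<in> Q. x \<le> z \<and> z \<le> y} = {}" and "x \<noteq> y" by auto
  then show ?thesis by (simp only: sum.empty if_False)
qed

definition compatible_incidence_algebra ::
  "'p::order set \<Rightarrow> 'q::order set \<Rightarrow> ('p \<Rightarrow> 'q) \<Rightarrow> ('p \<Rightarrow> 'p \<Rightarrow> real) set" where
  "compatible_incidence_algebra P Q \<phi> =
     {h \<in> incidence_algebra P.
        \<forall>q\<in>Q. \<forall>q'\<in>Q. \<forall>p1 \<in> {p \<in> P. \<phi> p = q'}. \<forall>p2 \<in> {p \<in> P. \<phi> p = q'}.
          (\<Sum>p \<in> {p \<in> P. \<phi> p = q}. h p p1) = (\<Sum>p \<in> {p \<in> P. \<phi> p = q}. h p p2)}"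

definition pushforward ::
  "'p set \<Rightarrow> ('p \<Rightarrow> 'q) \<Rightarrow> ('p \<Rightarrow> 'p \<Rightarrow> real) \<Rightarrow> 'q \<Rightarrow> 'q \<Rightarrow> real" where
  "pushforward P \<phi> h q q' =
     1 / real (card {p \<in> P. \<phi> p = q'}) *
     (\<Sum>p \<in> {p \<in> P. \<phi> p = q}. \<Sum>p' \<in> {p \<in> P. \<phi> p = q'}. h p p')"


section \<open>Faces and flats\<close>

definition face_lattice :: "'a::euclidean_space set \<Rightarrow> 'a set set" where
  "face_lattice P = {F. F face_of P}"

text \<open>
  The linear subspace parallel to the affine hull. With this formula the empty set is sent to the
  empty set, which is not a subspace and lies strictly below every subspace.
\<close>

definition lin_dir :: "'a::euclidean_space set \<Rightarrow> 'a set" where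
  "lin_dir F = {x - y | x y. x \<in> affine hull F \<and> y \<in> affine hull F}"

definition flats0 :: "'a::euclidean_space set \<Rightarrow> 'a set set" where
  "flats0 P = insert {} {lin_dir F | F. F face_of P \<and> F \<noteq> {}}"

lemma lin_dir_empty: "lin_dir {} = {}"
  by (simp add: lin_dir_def)

lemma flats0_eq_image: "flats0 P = lin_dir ` face_lattice P"
proof -
  have "face_lattice P = insert {} {F. F face_of P \<and> F \<noteq> {}}"
    by (auto simp: face_lattice_def)
  then have "lin_dir ` face_lattice P = insert (lin_dir {}) (lin_dir ` {F. F face_of P \<and> F \<noteq> {}})"
    by (simp only: image_insert)
  then show ?thesis
    by (simp only: flats0_def lin_dir_empty image_Collect)
qed

text \<open>
  \<open>e\<close> lists the \<open>n\<close> edges of a polygon \<open>G\<close> in cyclic order; such a list is unique up to rotation and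
  reflection, and if \<open>n = 2 * k\<close>, the edge antipodal to \<open>e i\<close> is \<open>e (i + k)\<close>.
\<close>

definition edge_cycle :: "'a::euclidean_space set \<Rightarrow> (nat \<Rightarrow> 'a set) \<Rightarrow> nat \<Rightarrow> bool" where
  "edge_cycle G e n \<longleftrightarrow>
     bij_betw e {..<n} {E. E edge_of G} \<and> (\<forall>i<n. e i \<inter> e (Suc i mod n) \<noteq> {})"

definition belt_polytope :: "'a::euclidean_space set \<Rightarrow> bool" where
  "belt_polytope P \<longleftrightarrow> polytope P \<and>
     (\<forall>G. G face_of P \<and> aff_dim G = 2 \<longrightarrow>
        (\<exists>e k. edge_cycle G e (2 * k) \<and> (\<forall>i<k. lin_dir (e i) = lin_dir (e (i + k)))))"


section \<open>Cone angles\<close>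

definition polyhedral_cone :: "'a::euclidean_space set \<Rightarrow> bool" where
  "polyhedral_cone C \<longleftrightarrow> polyhedron C \<and> convex_cone C"

text \<open>Values of \<open>\<alpha>\<close> on sets that are not polyhedral cones are unconstrained and irrelevant.\<close>

definition cone_angle :: "('a::euclidean_space set \<Rightarrow> real) \<Rightarrow> bool" where
  "cone_angle \<alpha> \<longleftrightarrow>
     (\<forall>C D. polyhedral_cone C \<and> polyhedral_cone D \<and> polyhedral_cone (C \<union> D) \<longrightarrow>
        \<alpha> (C \<union> D) = \<alpha> C + \<alpha> D - \<alpha> (C \<inter> D)) \<and>
     (\<forall>C. polyhedral_cone C \<and> aff_dim C < int DIM('a) \<longrightarrow> \<alpha> C = 0) \<and>
     \<alpha> UNIV = 1"

definition tangent_cone :: "'a::euclidean_space \<Rightarrow> 'a set \<Rightarrow> 'a set" where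
  "tangent_cone q G = convex_cone hull ((\<lambda>x. - q + x) ` G)"

text \<open>The choice of the point in \<open>interior_angle\<close> below is immaterial.\<close>

lemma tangent_cone_rel_interior_eq:
  fixes F G :: "'a::euclidean_space set"
  assumes "convex F" "F \<subseteq> G" "q \<in> rel_interior F" "q' \<in> rel_interior F"
  shows "tangent_cone q G = tangent_cone q' G"
proof -
  have sub: "tangent_cone a G \<subseteq> tangent_cone b G"
    if "a \<in> rel_interior F" "b \<in> rel_interior F" for a b
    unfolding tangent_cone_def
  proof (rule hull_minimal)
    let ?K = "convex_cone hull ((\<lambda>x. - b + x) ` G)"
    have "a \<in> F" using that rel_interior_subset by auto
    then have "F \<noteq> {}" by auto
    from that(2) have "\<forall>x\<in>F. \<exists>e. e > 1 \<and> (1 - e) *\<^sub>R x + e *\<^sub>R b \<in> F"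
      by (simp only: convex_rel_interior_iff[OF \<open>convex F\<close> \<open>F \<noteq> {}\<close>])
    with \<open>a \<in> F\<close> obtain e where e: "e > 1" "(1 - e) *\<^sub>R a + e *\<^sub>R b \<in> F"
      by (auto dest!: bspec[of F _ a])
    have p: "- b + ((1 - e) *\<^sub>R a + e *\<^sub>R b) \<in> ?K"
      using e assms(2) by (intro hull_inc) auto
    have "- a + x \<in> ?K" if "x \<in> G" for x
    proof -
      have "- b + x \<in> ?K" using that by (intro hull_inc) auto
      moreover have "(1 / (e - 1)) *\<^sub>R (- b + ((1 - e) *\<^sub>R a + e *\<^sub>R b)) \<in> ?K"
        using p e by (intro convex_cone_hull_mul) auto
      moreover have "- b + ((1 - e) *\<^sub>R a + e *\<^sub>R b) = (e - 1) *\<^sub>R (b - a)"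
        by (simp add: algebra_simps)
      then have "(1 / (e - 1)) *\<^sub>R (- b + ((1 - e) *\<^sub>R a + e *\<^sub>R b)) = b - a"
        using e by simp
      ultimately have "(- b + x) + (b - a) \<in> ?K"
        by (metis convex_cone_hull_add)
      then show ?thesis by simp
    qed
    then show "(\<lambda>x. - a + x) ` G \<subseteq> ?K" by auto
    show "convex_cone ?K" by (rule convex_cone_convex_cone_hull)
  qed
  show ?thesis
    using sub[OF assms(3,4)] sub[OF assms(4,3)] by (rule equalityI)
qed

definition normal_cone :: "'a::euclidean_space set \<Rightarrow> 'a set \<Rightarrow> 'a set" where
  "normal_cone F G = {c. \<forall>x\<in>F. \<forall>y\<in>G. c \<bullet> x \<ge> c \<bullet> y}"

text \<open>Sums of sets are Minkowski sums; note that \<open>aff_dim {} = -1\<close>.\<close>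

definition interior_angle ::
  "('a::euclidean_space set \<Rightarrow> real) \<Rightarrow> 'a set \<Rightarrow> 'a set \<Rightarrow> 'a set \<Rightarrow> real" where
  "interior_angle \<alpha> P F G =
     (if F face_of P \<and> G face_of P \<and> F \<subseteq> G then
        if F = {} then (if aff_dim G \<le> 0 then 1 else 0)
        else \<alpha> (tangent_cone (SOME q. q \<in> rel_interior F) G + (lin_dir G)\<^sup>\<bottom>)
      else 0)"

definition exterior_angle ::
  "('a::euclidean_space set \<Rightarrow> real) \<Rightarrow> 'a set \<Rightarrow> 'a set \<Rightarrow> 'a set \<Rightarrow> real" where
  "exterior_angle \<alpha> P F G =
     (if F face_of P \<and> G face_of P \<and> F \<subseteq> G then
        if F = {} then 1 else \<alpha> (normal_cone F G + lin_dir F)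
      else 0)"

definition signed_interior_angle ::
  "('a::euclidean_space set \<Rightarrow> real) \<Rightarrow> 'a set \<Rightarrow> 'a set \<Rightarrow> 'a set \<Rightarrow> real" where
  "signed_interior_angle \<alpha> P F G =
     (-1) powi (aff_dim G - aff_dim F) * interior_angle \<alpha> P F G"

end

theory Submission
  imports Defs
begin

text \<open>
  The belt condition says that every edge direction survives in all faces it could survive in: a
  simplex-method step from an edge leads into a 2-face, whose antipodal edge is parallel and better,
  so for \<open>c\<close> orthogonal to an edge the face maximising \<open>c\<close> contains a parallel edge. Hence, for a
  flat \<open>L\<close>, the normal cones of the faces \<open>J\<close> of \<open>G\<close> with \<open>L \<subseteq> lin_dir J\<close> are the cells
  of a central hyperplane arrangement in the orthogonal complement of \<open>L\<close>.

  On finitely many cones a cone angle is an affine combination of evaluations at generic points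
  \<open>w\<close>, so linear relations between angles need only be checked for these. A generic \<open>w\<close> lies in
  exactly one chamber of the arrangement, which gives the exterior angle sums. For the interior
  angles, \<open>w\<close> lies in the tangent cone at \<open>J\<close> iff the cell of \<open>J\<close> does not meet the open half-space
  of functionals positive on \<open>w\<close>; the Euler relations for the whole space and for this half-space
  cancel, so the signed interior angles sum to zero over all \<open>J\<close> with \<open>L \<subseteq> lin_dir J\<close>. This is the
  recursion that characterises the Moebius function.
\<close>

section \<open>Directions of faces\<close>

lemma lin_dir_eq_span:
  assumes "a \<in> F"
  shows "lin_dir F = span ((\<lambda>x. x - a) ` F)"
proof -
  define S where "S = span ((\<lambda>x. x - a) ` F)"
  have "affine hull F = (\<lambda>x. x + a) ` ((\<lambda>x. x - a) ` (affine hull F))"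
    by (simp add: image_image)
  also have "\<dots> = (\<lambda>x. x + a) ` S"
    by (simp only: diffs_affine_hull_span[OF assms] S_def)
  finally have aff: "affine hull F = (\<lambda>x. x + a) ` S" .
  have "x \<in> lin_dir F" if "x \<in> S" for x
  proof -
    have "x + a \<in> affine hull F" "0 + a \<in> affine hull F"
      unfolding aff using that by (auto simp: S_def span_zero)
    moreover have "x = (x + a) - (0 + a)" by simp
    ultimately show ?thesis unfolding lin_dir_def by blast
  qed
  moreover have "lin_dir F \<subseteq> S"
    unfolding lin_dir_def aff by (auto simp: S_def span_diff)
  ultimately show ?thesis unfolding S_def by blast
qed

lemma subspace_lin_dir: "F \<noteq> {} \<Longrightarrow> subspace (lin_dir F)"
  by (metis ex_in_conv lin_dir_eq_span subspace_span)

lemma zero_in_lin_dir_iff: "0 \<in> lin_dir F \<longleftrightarrow> F \<noteq> {}"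
  using subspace_lin_dir subspace_0 lin_dir_empty by blast

lemma lin_dir_eq_empty_iff: "lin_dir F = {} \<longleftrightarrow> F = {}"
  using zero_in_lin_dir_iff lin_dir_empty by blast

lemma lin_dir_mono: "F \<subseteq> G \<Longrightarrow> lin_dir F \<subseteq> lin_dir G"
  unfolding lin_dir_def using hull_mono[of F G affine] by blast

lemma diff_in_lin_dir: "x \<in> F \<Longrightarrow> y \<in> F \<Longrightarrow> x - y \<in> lin_dir F"
  unfolding lin_dir_def using hull_inc[of _ F affine] by blast

lemma aff_dim_eq_dim_lin_dir: "F \<noteq> {} \<Longrightarrow> aff_dim F = int (dim (lin_dir F))"
proof -
  assume "F \<noteq> {}"
  then obtain a where a: "a \<in> F" by blast
  have "aff_dim F = int (dim ((\<lambda>x. - a + x) ` F))"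
    using a by (intro aff_dim_eq_dim hull_inc)
  then show ?thesis
    by (simp add: lin_dir_eq_span[OF a] algebra_simps)
qed

text \<open>Orthogonality to a flat and constancy on a face are used interchangeably from here on;
  \<open>a\<close> serves as a base point of the affine hull.\<close>

lemma orthogonal_lin_dir_iff:
  assumes "a \<in> F"
  shows "c \<in> (lin_dir F)\<^sup>\<bottom> \<longleftrightarrow> (\<forall>x\<in>F. c \<bullet> x = c \<bullet> a)"
proof
  assume "c \<in> (lin_dir F)\<^sup>\<bottom>"
  then show "\<forall>x\<in>F. c \<bullet> x = c \<bullet> a"
    using diff_in_lin_dir[OF _ assms]
    by (force simp: orthogonal_comp_def orthogonal_def inner_commute inner_diff_right)
next
  assume *: "\<forall>x\<in>F. c \<bullet> x = c \<bullet> a"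
  have "span ((\<lambda>x. x - a) ` F) \<subseteq> {x. c \<bullet> x = 0}"
    using * by (intro span_minimal subspace_hyperplane) (auto simp: inner_diff_right)
  then show "c \<in> (lin_dir F)\<^sup>\<bottom>"
    by (auto simp: lin_dir_eq_span[OF assms] orthogonal_comp_def orthogonal_def inner_commute)
qed

text \<open>Proper faces drop in dimension, and dimension is read off the direction. Thus no face
  properly contains a face parallel to it.\<close>

lemma face_eq_if_lin_dir_eq:
  assumes "convex G" "F face_of G" "lin_dir F = lin_dir G"
  shows "F = G"
proof (rule ccontr)
  assume "F \<noteq> G"
  with assms have "aff_dim F < aff_dim G" by (intro face_of_aff_dim_lt)
  moreover have "F \<noteq> {}" "G \<noteq> {}"
    using \<open>F \<noteq> G\<close> assms by (metis lin_dir_eq_empty_iff)+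
  ultimately show False
    using assms by (simp add: aff_dim_eq_dim_lin_dir)
qed

lemma proj_ex:
  fixes U :: "'a::euclidean_space set"
  assumes "subspace U"
  obtains p where "p \<in> U" "w - p \<in> U\<^sup>\<bottom>"
proof -
  have "w \<in> U + U\<^sup>\<bottom>" using subspace_sum_orthogonal_comp[OF assms] by simp
  then show thesis using that by (auto elim!: set_plus_elim)
qed

lemma inner_orthogonal_comp: "x \<in> U \<Longrightarrow> y \<in> U\<^sup>\<bottom> \<Longrightarrow> x \<bullet> y = 0"
  by (simp add: orthogonal_comp_def orthogonal_def)

text \<open>Supplies normals of hyperplanes that generic points have to avoid: the part of a vector
  of V orthogonal to U is nonzero as soon as the vector is outside U.\<close>

lemma psubset_subspace_orthogonal_ex:
  fixes U V :: "'a::euclidean_space set"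
  assumes "subspace U" "subspace V" "U \<subset> V"
  obtains b where "b \<in> V" "b \<in> U\<^sup>\<bottom>" "b \<noteq> 0"
proof -
  obtain x where x: "x \<in> V" "x \<notin> U" using assms by blast
  obtain p where p: "p \<in> U" "x - p \<in> U\<^sup>\<bottom>" using proj_ex[OF assms(1)] .
  show thesis
    by (rule that[of "x - p"]) (use x p assms in \<open>auto intro: subspace_diff\<close>)
qed

section \<open>Faces maximising a linear functional\<close>

text \<open>For a nonempty polytope \<open>G\<close>, the fibres of \<open>max_face G\<close> are
  the relatively open cones of its normal fan. The fan is handled through this map only.\<close>

definition max_face :: "'a::euclidean_space set \<Rightarrow> 'a \<Rightarrow> 'a set" where
  "max_face G c = {x \<in> G. \<forall>y\<in>G. c \<bullet> y \<le> c \<bullet> x}"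

lemma max_face_eq:
  "x \<in> max_face G c \<Longrightarrow> max_face G c = G \<inter> {y. c \<bullet> y = c \<bullet> x}"
  by (force simp: max_face_def)

lemma max_face_nonempty:
  assumes "polytope G" "G \<noteq> {}"
  shows "max_face G c \<noteq> {}"
proof -
  have "\<exists>x\<in>G. \<forall>y\<in>G. c \<bullet> y \<le> c \<bullet> x"
    using assms by (intro continuous_attains_sup) (auto simp: polytope_imp_compact intro: continuous_intros)
  then show ?thesis by (auto simp: max_face_def)
qed

lemma max_face_face_of: "convex G \<Longrightarrow> max_face G c face_of G"
proof (cases "max_face G c = {}")
  case False
  assume "convex G"
  obtain x where x: "x \<in> max_face G c" using False by blast
  show ?thesis
    unfolding max_face_eq[OF x] using \<open>convex G\<close> x
    by (intro face_of_Int_supporting_hyperplane_le) (auto simp: max_face_def)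
qed auto

lemma face_eq_max_face:
  assumes "polytope G" "F face_of G" "F \<noteq> {}"
  obtains c where "max_face G c = F"
proof -
  have "F exposed_face_of G"
    using assms by (simp add: exposed_face_of_polyhedron polytope_imp_polyhedron)
  then obtain c b where *: "G \<subseteq> {x. c \<bullet> x \<le> b}" "F = G \<inter> {x. c \<bullet> x = b}"
    by (auto simp: exposed_face_of_def)
  then have "max_face G c = F"
    using assms(3) by (force simp: max_face_def)
  then show thesis by (rule that)
qed

lemma max_face_orthogonal_lin_dir:
  "max_face G c \<noteq> {} \<Longrightarrow> c \<in> (lin_dir (max_face G c))\<^sup>\<bottom>"
proof -
  assume "max_face G c \<noteq> {}"
  then obtain a where a: "a \<in> max_face G c" by blast
  then show ?thesis
    using orthogonal_lin_dir_iff[OF a, of c] max_face_eq[OF a] by blast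
qed

text \<open>A common maximiser attains both upper bounds at once, so a positive combination is
  maximal exactly where neither summand loses anything.\<close>

lemma max_face_add:
  assumes "max_face G c \<inter> max_face G c' \<noteq> {}" "0 < s" "0 < t"
  shows "max_face G (s *\<^sub>R c + t *\<^sub>R c') = max_face G c \<inter> max_face G c'"
proof -
  obtain z where z: "z \<in> G" "\<And>y. y \<in> G \<Longrightarrow> c \<bullet> y \<le> c \<bullet> z" "\<And>y. y \<in> G \<Longrightarrow> c' \<bullet> y \<le> c' \<bullet> z"
    using assms(1) by (auto simp: max_face_def)
  have "x \<in> max_face G c \<inter> max_face G c'" if x: "x \<in> max_face G (s *\<^sub>R c + t *\<^sub>R c')" for x
  proof -
    have "x \<in> G" using x by (simp add: max_face_def)
    have 1: "s * (c \<bullet> z) + t * (c' \<bullet> z) \<le> s * (c \<bullet> x) + t * (c' \<bullet> x)"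
      using x z by (simp add: max_face_def inner_add_left)
    have 2: "s * (c \<bullet> x) \<le> s * (c \<bullet> z)" "t * (c' \<bullet> x) \<le> t * (c' \<bullet> z)"
      using z(2,3)[OF \<open>x \<in> G\<close>] assms by (auto intro: mult_left_mono)
    then have "s * (c \<bullet> x) = s * (c \<bullet> z)" "t * (c' \<bullet> x) = t * (c' \<bullet> z)"
      using 1 by linarith+
    then have "c \<bullet> x = c \<bullet> z" "c' \<bullet> x = c' \<bullet> z" using assms by auto
    then show ?thesis using z \<open>x \<in> G\<close> by (simp add: max_face_def)
  qed
  moreover have "x \<in> max_face G (s *\<^sub>R c + t *\<^sub>R c')"
    if "x \<in> max_face G c \<inter> max_face G c'" for x
    using that assms by (auto simp: max_face_def inner_add_left intro!: add_mono mult_left_mono)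
  ultimately show ?thesis by blast
qed

section \<open>Simplex steps between faces, and edge directions\<close>

lemma polytope_subset_convex_if_extreme_points:
  fixes G :: "'a::euclidean_space set"
  assumes "polytope G" "convex C" "\<And>v. v extreme_point_of G \<Longrightarrow> v \<in> C"
  shows "G \<subseteq> C"
proof -
  have "G = convex hull {v. v extreme_point_of G}"
    using assms(1) by (intro Krein_Milman_Minkowski) (auto simp: polytope_imp_compact polytope_imp_convex)
  also have "\<dots> \<subseteq> C" using assms by (intro hull_minimal) auto
  finally show ?thesis .
qed

text \<open>
  The slope \<open>\<rho>\<close> is the largest ratio of the gain in \<open>c\<close> to the loss in \<open>h\<close> among the vertices
  outside \<open>E\<close>; the vertices attaining it span, together with \<open>E\<close>, the face \<open>K\<close>.
\<close>

lemma tilted_face_ex: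
  fixes G :: "'a::euclidean_space set"
  assumes G: "polytope G"
    and h: "\<forall>x\<in>G. h \<bullet> x \<le> m" "G \<inter> {x. h \<bullet> x = m} = E"
    and c: "\<forall>x\<in>E. c \<bullet> x = \<gamma>" and "\<exists>x\<in>G. c \<bullet> x > \<gamma>"
  obtains \<rho> K where "\<rho> > 0" "K face_of G" "E \<subseteq> K" "\<exists>y\<in>K. c \<bullet> y > \<gamma>"
    "K = G \<inter> {x. c \<bullet> x - \<gamma> = \<rho> * (m - h \<bullet> x)}"
proof -
  define V where "V = {v. v extreme_point_of G \<and> v \<notin> E}"
  define r where "r = (\<lambda>v. (c \<bullet> v - \<gamma>) / (m - h \<bullet> v))"
  obtain x0 where x0: "x0 \<in> G" "c \<bullet> x0 > \<gamma>" using assms(5) by blast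
  have fin: "finite V"
    using finite_polyhedron_extreme_points[OF polytope_imp_polyhedron[OF G]]
    by (auto simp: V_def intro: finite_subset[rotated])
  \<comment> \<open>If all vertices lay in \<open>E\<close>, this half-space would contain
    \<open>G\<close>, against the improving point \<open>x0\<close>.\<close>
  have "convex {x. c \<bullet> x \<le> \<gamma>}" by (rule convex_halfspace_le)
  then have "V \<noteq> {}"
    using polytope_subset_convex_if_extreme_points[OF G, of "{x. c \<bullet> x \<le> \<gamma>}"] x0 c
    by (force simp: V_def)
  define \<rho> where "\<rho> = Max (r ` V)"
  have pos: "m - h \<bullet> v > 0" if "v \<in> V" for v
    using that h by (force simp: V_def extreme_point_of_def order_less_le)
  \<comment> \<open>The tilted functional \<open>c + \<rho> *\<^sub>R h\<close> supports
    \<open>G\<close>: equality holds on \<open>E\<close>, and at the other vertices the maximality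
    of \<rho> is precisely the required inequality.\<close>
  have le: "c \<bullet> x + \<rho> * (h \<bullet> x) \<le> \<gamma> + \<rho> * m" if "x \<in> G" for x
  proof -
    have "G \<subseteq> {x. (c + \<rho> *\<^sub>R h) \<bullet> x \<le> \<gamma> + \<rho> * m}"
    proof (rule polytope_subset_convex_if_extreme_points[OF G convex_halfspace_le])
      fix v assume v: "v extreme_point_of G"
      show "v \<in> {x. (c + \<rho> *\<^sub>R h) \<bullet> x \<le> \<gamma> + \<rho> * m}"
      proof (cases "v \<in> E")
        case True
        then show ?thesis using h c by (auto simp: inner_add_left)
      next
        case False
        then have "v \<in> V" using v by (simp add: V_def)
        then have "r v \<le> \<rho>" using fin by (simp add: \<rho>_def)
        then show ?thesis
          using pos[OF \<open>v \<in> V\<close>] by (simp add: r_def inner_add_left pos_divide_le_eq algebra_simps)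
      qed
    qed
    then show ?thesis using that by (auto simp: inner_add_left)
  qed
  have \<rho>: "\<rho> > 0"
  proof (rule ccontr)
    assume "\<not> \<rho> > 0"
    then have "\<rho> * (m - h \<bullet> x0) \<le> 0"
      using bspec[OF h(1) x0(1)] by (intro mult_nonpos_nonneg) auto
    then show False using le[OF x0(1)] x0(2) by (simp add: algebra_simps)
  qed
  have "\<rho> \<in> r ` V" unfolding \<rho>_def using fin \<open>V \<noteq> {}\<close> by (intro Max_in) auto
  then obtain v where v: "v \<in> V" "\<rho> = r v" by blast
  have vG: "v \<in> G" using v(1) by (auto simp: V_def extreme_point_of_def)
  have vr: "c \<bullet> v - \<gamma> = \<rho> * (m - h \<bullet> v)"
    using v pos[OF v(1)] by (simp add: r_def)
  have Keq: "G \<inter> {x. c \<bullet> x - \<gamma> = \<rho> * (m - h \<bullet> x)} = G \<inter> {x. (c + \<rho> *\<^sub>R h) \<bullet> x = \<gamma> + \<rho> * m}"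
    by (auto simp: inner_add_left algebra_simps)
  show thesis
  proof (rule that[OF \<rho> _ _ _ refl])
    show "G \<inter> {x. c \<bullet> x - \<gamma> = \<rho> * (m - h \<bullet> x)} face_of G"
      unfolding Keq using le G
      by (intro face_of_Int_supporting_hyperplane_le) (auto simp: polytope_imp_convex inner_add_left)
    show "E \<subseteq> G \<inter> {x. c \<bullet> x - \<gamma> = \<rho> * (m - h \<bullet> x)}" using h c by auto
    have "c \<bullet> v > \<gamma>" using vr \<rho> pos[OF v(1)] by (metis diff_gt_0_iff_gt mult_pos_pos)
    then show "\<exists>y\<in>G \<inter> {x. c \<bullet> x - \<gamma> = \<rho> * (m - h \<bullet> x)}. \<gamma> < c \<bullet> y" using vr vG by blast
  qed
qed

lemma exposing_functional_ex:
  fixes G :: "'a::euclidean_space set"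
  assumes "polytope G" "F face_of G"
  obtains h m where "\<forall>x\<in>G. h \<bullet> x \<le> m" "G \<inter> {x. h \<bullet> x = m} = F"
proof -
  have "F exposed_face_of G"
    using assms by (simp add: exposed_face_of_polyhedron polytope_imp_polyhedron)
  then show thesis using that by (auto simp: exposed_face_of_def)
qed

text \<open>The simplex-method step, starting from a face instead of a vertex.\<close>

lemma improving_face_ex:
  fixes G :: "'a::euclidean_space set"
  assumes G: "polytope G" and E: "E face_of G" "E \<noteq> {}"
    and c: "\<forall>x\<in>E. c \<bullet> x = \<gamma>" and x: "x \<in> G" "c \<bullet> x > \<gamma>"
  obtains K y where "K face_of G" "E \<subseteq> K" "aff_dim K = aff_dim E + 1" "y \<in> K" "c \<bullet> y > \<gamma>"
proof -
  \<comment> \<open>The face sought is one of least dimension among those that contain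
    \<open>E\<close> and improve on it.\<close>
  define Q where "Q = (\<lambda>K. K face_of G \<and> E \<subseteq> K \<and> (\<exists>y\<in>K. c \<bullet> y > \<gamma>))"
  have "Q G" using assms by (auto simp: Q_def polytope_imp_convex face_of_refl face_of_imp_subset)
  then obtain K where K: "Q K" and min: "\<And>K'. Q K' \<Longrightarrow> nat (aff_dim K) \<le> nat (aff_dim K')"
    using ex_has_least_nat[of Q G "\<lambda>K. nat (aff_dim K)"] by blast
  have KG: "K face_of G" "E \<subseteq> K" "\<exists>y\<in>K. c \<bullet> y > \<gamma>" using K by (auto simp: Q_def)
  have pK: "polytope K" using G KG(1) by (rule face_of_polytope_polytope)
  have EK: "E face_of K" using E(1) KG by (meson face_of_imp_subset face_of_subset)
  \<comment> \<open>By minimality the tilted face is all of \<open>K\<close>. So on \<open>K\<close>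
    the gain in \<open>c\<close> is proportional to the gap of any functional exposing
    \<open>E\<close>.\<close>
  have tilt: "\<exists>\<rho>>0. \<forall>x\<in>K. c \<bullet> x - \<gamma> = \<rho> * (m - h \<bullet> x)"
    if hm: "\<forall>x\<in>K. h \<bullet> x \<le> m" "K \<inter> {x. h \<bullet> x = m} = E" for h m
  proof -
    obtain \<rho> K' where *: "\<rho> > 0" "K' face_of K" "E \<subseteq> K'" "\<exists>y\<in>K'. c \<bullet> y > \<gamma>"
        "K' = K \<inter> {x. c \<bullet> x - \<gamma> = \<rho> * (m - h \<bullet> x)}"
      by (rule tilted_face_ex[OF pK hm c KG(3)])
    have "Q K'" using * KG face_of_trans by (auto simp: Q_def)
    have "K' = K"
    proof (rule ccontr)
      assume "K' \<noteq> K"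
      then have "aff_dim K' < aff_dim K"
        using * pK by (intro face_of_aff_dim_lt) (auto simp: polytope_imp_convex)
      moreover have "\<not> aff_dim K' < 0"
        using * E by (subst aff_dim_negative_iff) auto
      ultimately show False using min[OF \<open>Q K'\<close>] by linarith
    qed
    then show ?thesis using * by blast
  qed
  have "E \<noteq> K" using KG c by force
  then obtain D where D: "D facet_of K" "E \<subseteq> D"
    by (rule face_of_polyhedron_subset_facet[OF polytope_imp_polyhedron[OF pK] EK E(2)])
  obtain h m where hm: "\<forall>x\<in>K. h \<bullet> x \<le> m" "K \<inter> {x. h \<bullet> x = m} = E"
    by (rule exposing_functional_ex[OF pK EK])
  obtain a b where ab: "\<forall>x\<in>K. a \<bullet> x \<le> b" "K \<inter> {x. a \<bullet> x = b} = D"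
    by (rule exposing_functional_ex[OF pK facet_of_imp_face_of[OF D(1)]])
  obtain \<rho> where \<rho>: "\<rho> > 0" "\<forall>x\<in>K. c \<bullet> x - \<gamma> = \<rho> * (m - h \<bullet> x)"
    using tilt[OF hm] by blast
  \<comment> \<open>If \<open>h\<close> exposes \<open>E\<close> and \<open>a\<close> exposes a
    facet \<open>D\<close> containing \<open>E\<close>, then \<open>h + a\<close> exposes
    \<open>E\<close> too. Comparing the two proportionalities makes the gaps of \<open>a\<close> and
    \<open>h\<close> proportional, which will force \<open>D = E\<close>.\<close>
  have "K \<inter> {x. (h + a) \<bullet> x = m + b} = E"
  proof -
    have "h \<bullet> x = m \<and> a \<bullet> x = b" if "x \<in> K" "h \<bullet> x + a \<bullet> x = m + b" for x
      using bspec[OF hm(1) that(1)] bspec[OF ab(1) that(1)] that(2) by linarith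
    moreover have "h \<bullet> x = m" "a \<bullet> x = b" if "x \<in> E" for x using that D(2) hm ab by auto
    ultimately show ?thesis using hm(2) by (auto simp: inner_add_left)
  qed
  moreover have "\<forall>x\<in>K. (h + a) \<bullet> x \<le> m + b"
    using hm(1) ab(1) by (auto simp: inner_add_left intro: add_mono)
  ultimately obtain \<rho>' where \<rho>': "\<rho>' > 0" "\<forall>x\<in>K. c \<bullet> x - \<gamma> = \<rho>' * ((m + b) - (h + a) \<bullet> x)"
    using tilt[of "h + a" "m + b"] by blast
  have eq: "\<rho>' * (b - a \<bullet> x) = (\<rho> - \<rho>') * (m - h \<bullet> x)" if "x \<in> K" for x
    using bspec[OF \<rho>(2) that] bspec[OF \<rho>'(2) that] by (simp add: inner_add_left algebra_simps)
  have "D \<noteq> K" using D by auto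
  moreover have "D \<subseteq> K" using D facet_of_imp_subset by blast
  ultimately obtain z where z: "z \<in> K" "z \<notin> D" by blast
  then have "b - a \<bullet> z > 0" using bspec[OF ab(1) z(1)] ab(2) by force
  \<comment> \<open>A point off the facet shows that the factor of proportionality is not zero; then
    a vanishing gap of \<open>a\<close> implies a vanishing gap of \<open>h\<close>.\<close>
  then have "(\<rho> - \<rho>') * (m - h \<bullet> z) > 0" using eq[OF z(1)] \<rho>'(1) by (metis mult_pos_pos)
  then have "\<rho> - \<rho>' > 0" using bspec[OF hm(1) z(1)] by (simp add: zero_less_mult_iff)
  then have "D \<subseteq> E" using eq ab(2) hm(2) by force
  then have "E = D" using D by blast
  then have "aff_dim K = aff_dim E + 1" using D(1) by (simp add: facet_of_def)
  then show thesis using that KG by blast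
qed

text \<open>From a vertex that does not maximise \<open>c\<close> some edge improves
  \<open>c\<close>, but \<open>c\<close> is constant along edges. So all vertices are maximisers,
  and \<open>c\<close> is constant on their convex hull.\<close>

lemma orthogonal_edges_imp_constant:
  fixes F :: "'a::euclidean_space set"
  assumes F: "polytope F" and E: "\<And>E. E edge_of F \<Longrightarrow> c \<in> (lin_dir E)\<^sup>\<bottom>"
    and "x \<in> F" "y \<in> F"
  shows "c \<bullet> x = c \<bullet> y"
proof -
  have le: "c \<bullet> z \<le> c \<bullet> v" if v: "v extreme_point_of F" and z: "z \<in> F" for v z
  proof (rule ccontr)
    assume "\<not> c \<bullet> z \<le> c \<bullet> v"
    moreover have "{v} face_of F" using v by (simp add: face_of_singleton)
    ultimately obtain K y where K: "K face_of F" "{v} \<subseteq> K" "aff_dim K = 1" "y \<in> K" "c \<bullet> y > c \<bullet> v"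
      using improving_face_ex[OF F, of "{v}" c "c \<bullet> v" z] z by auto
    then have "c \<in> (lin_dir K)\<^sup>\<bottom>" by (intro E) (simp add: edge_of_def)
    then have "c \<bullet> y = c \<bullet> v" using K orthogonal_lin_dir_iff[of v K c] by blast
    then show False using K by simp
  qed
  obtain v where v: "v extreme_point_of F"
    using F assms(3) extreme_point_exists_convex
    by (metis empty_iff polytope_imp_compact polytope_imp_convex)
  have "v \<in> F" using v by (simp add: extreme_point_of_def)
  have "F \<subseteq> {z. c \<bullet> z = c \<bullet> v}"
    using le v \<open>v \<in> F\<close>
    by (intro polytope_subset_convex_if_extreme_points[OF F convex_hyperplane])
       (auto simp: extreme_point_of_def intro!: antisym)
  then have "c \<bullet> x = c \<bullet> v" "c \<bullet> y = c \<bullet> v" using \<open>x \<in> F\<close> \<open>y \<in> F\<close> by blast+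
  then show ?thesis by simp
qed

text \<open>The edge directions span the direction of a polytope. Dually: the component of
  \<open>x\<close> orthogonal to \<open>X\<close> is constant along edges, hence on
  \<open>F\<close>, hence orthogonal to \<open>x\<close> itself, and so it vanishes.\<close>

lemma lin_dir_subset_if_edges:
  fixes F :: "'a::euclidean_space set"
  assumes F: "polytope F" and X: "subspace X" and E: "\<And>E. E edge_of F \<Longrightarrow> lin_dir E \<subseteq> X"
  shows "lin_dir F \<subseteq> X"
proof
  fix x assume x: "x \<in> lin_dir F"
  then obtain a where a: "a \<in> F" using lin_dir_empty by (metis empty_iff ex_in_conv)
  obtain p where p: "p \<in> X" "x - p \<in> X\<^sup>\<bottom>" using proj_ex[OF X] .
  have "x - p \<in> (lin_dir E)\<^sup>\<bottom>" if "E edge_of F" for E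
    using orthogonal_comp_anti_mono[OF E[OF that]] p by blast
  then have "x - p \<in> (lin_dir F)\<^sup>\<bottom>"
    using orthogonal_edges_imp_constant[OF F] a by (subst orthogonal_lin_dir_iff[OF a]) metis
  then have "x \<bullet> (x - p) = 0" "p \<bullet> (x - p) = 0"
    using x p by (auto intro: inner_orthogonal_comp)
  then have "(x - p) \<bullet> (x - p) = 0" by (simp add: inner_diff_left)
  then show "x \<in> X" using p by simp
qed

section \<open>Polyhedral cones and cone angles\<close>

text \<open>In a description by half-spaces every bound can be replaced by 0: it is nonnegative
  because 0 is in the cone, and a point with a positive value could be scaled past it. The normals
  stay nonzero, as the sampling of chambers requires.\<close>

lemma polyhedral_cone_halfspaces_ex:
  assumes "polyhedral_cone C"
  obtains A where "finite A" "0 \<notin> A" "C = {x. \<forall>a\<in>A. a \<bullet> x \<le> 0}"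
proof -
  obtain F where F: "finite F" "C = \<Inter>F" "\<forall>h\<in>F. \<exists>a b. a \<noteq> 0 \<and> h = {x. a \<bullet> x \<le> b}"
    using assms by (auto simp: polyhedral_cone_def polyhedron_def)
  then obtain a b where ab: "\<And>h. h \<in> F \<Longrightarrow> a h \<noteq> 0 \<and> h = {x. a h \<bullet> x \<le> b h}"
    by metis
  have C: "convex_cone C" using assms by (simp add: polyhedral_cone_def)
  have b0: "0 \<le> b h" if "h \<in> F" for h
  proof -
    have "0 \<in> h" using convex_cone_contains_0[OF C] F(2) that by blast
    then show ?thesis using ab[OF that] by (metis inner_zero_right mem_Collect_eq)
  qed
  have "a h \<bullet> x \<le> 0" if h: "h \<in> F" and x: "x \<in> C" for h x
  proof (rule ccontr)
    assume pos: "\<not> a h \<bullet> x \<le> 0"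
    \<comment> \<open>Scaled so that the functional takes the value \<open>b h + 1\<close>, just
      beyond the bound.\<close>
    define t where "t = (b h + 1) / (a h \<bullet> x)"
    have "t \<ge> 0" using pos b0[OF h] by (simp add: t_def)
    then have "t *\<^sub>R x \<in> h" using convex_cone_scaleR[OF C _ x] F(2) h by blast
    then have "a h \<bullet> (t *\<^sub>R x) \<le> b h" using ab[OF h] by blast
    then show False using pos by (simp add: t_def)
  qed
  moreover have "x \<in> C" if "\<forall>h\<in>F. a h \<bullet> x \<le> 0" for x
  proof -
    have "x \<in> h" if "h \<in> F" for h
      using ab[OF that] b0[OF that] \<open>\<forall>h\<in>F. a h \<bullet> x \<le> 0\<close> that by force
    then show ?thesis using F(2) by blast
  qed
  ultimately have "C = {x. \<forall>c\<in>a ` F. c \<bullet> x \<le> 0}" by blast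
  moreover have "0 \<notin> a ` F" using ab by force
  ultimately show thesis using that[of "a ` F"] F(1) by simp
qed

lemma polyhedral_cone_halfspaces:
  fixes A :: "'a::euclidean_space set"
  assumes "finite A"
  shows "polyhedral_cone {x. \<forall>a\<in>A. a \<bullet> x \<le> 0}"
proof -
  have "{x. \<forall>a\<in>A. a \<bullet> x \<le> 0} = \<Inter> ((\<lambda>a. {x. a \<bullet> x \<le> 0}) ` A)" by auto
  moreover have "polyhedron \<dots>"
    using assms by (intro polyhedron_Inter) (auto intro: polyhedron_halfspace_le)
  ultimately show ?thesis
    by (auto simp: polyhedral_cone_def convex_cone_iff inner_add_right mult_nonneg_nonpos
             intro!: add_nonpos_nonpos)
qed

lemma polyhedral_cone_UNIV: "polyhedral_cone UNIV"
  using polyhedral_cone_halfspaces[of "{}"] by simp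

lemma polyhedral_cone_Int:
  "polyhedral_cone C \<Longrightarrow> polyhedral_cone D \<Longrightarrow> polyhedral_cone (C \<inter> D)"
  by (auto simp: polyhedral_cone_def convex_cone_iff)

text \<open>Both angles are taken of such cylinders, with \<open>U\<close> the direction of
  \<open>G\<close> for interior angles and the orthogonal complement of the direction of
  \<open>F\<close> for exterior ones. Membership is thereby decided by the orthogonal projection
  \<open>p\<close> of \<open>w\<close>.\<close>

lemma mem_cylinder_iff:
  fixes U :: "'a::euclidean_space set"
  assumes "subspace U" "C \<subseteq> U" "p \<in> U" "w - p \<in> U\<^sup>\<bottom>"
  shows "w \<in> C + U\<^sup>\<bottom> \<longleftrightarrow> p \<in> C"
proof
  assume "w \<in> C + U\<^sup>\<bottom>"
  then obtain x r where x: "x \<in> C" "r \<in> U\<^sup>\<bottom>" "w = x + r" by (auto elim: set_plus_elim)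
  have "(w - p) - r \<in> U\<^sup>\<bottom>" by (rule subspace_diff[OF subspace_orthogonal_comp assms(4) x(2)])
  then have "x - p \<in> U\<^sup>\<bottom>" using x by simp
  moreover have "x - p \<in> U" using assms x by (auto intro: subspace_diff)
  ultimately have "x - p = 0" using orthogonal_Int_0[OF assms(1)] by blast
  then show "p \<in> C" using x by simp
next
  assume "p \<in> C"
  then have "p + (w - p) \<in> C + U\<^sup>\<bottom>" using assms by (intro set_plus_intro)
  then show "w \<in> C + U\<^sup>\<bottom>" by simp
qed

lemma polyhedral_cone_cylinder:
  fixes U :: "'a::euclidean_space set"
  assumes "subspace U" "C \<subseteq> U" "polyhedral_cone C"
  shows "polyhedral_cone (C + U\<^sup>\<bottom>)"
proof -
  obtain A where A: "finite A" "C = {x. \<forall>a\<in>A. a \<bullet> x \<le> 0}"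
    using polyhedral_cone_halfspaces_ex[OF assms(3)] by blast
  have "\<exists>p. p \<in> U \<and> w - p \<in> U\<^sup>\<bottom>" for w using proj_ex[OF assms(1), of w] by blast
  then obtain \<pi> where \<pi>: "\<And>w. \<pi> w \<in> U" "\<And>w. w - \<pi> w \<in> U\<^sup>\<bottom>" by metis
  \<comment> \<open>Orthogonal projection is self-adjoint, so the cylinder is cut out by the
    projected normals of \<open>C\<close>.\<close>
  have adj: "\<pi> a \<bullet> w = a \<bullet> \<pi> w" for a w
  proof -
    have "\<pi> a \<bullet> (w - \<pi> w) = 0" "\<pi> w \<bullet> (a - \<pi> a) = 0"
      using \<pi> by (auto intro: inner_orthogonal_comp)
    then show ?thesis by (simp add: inner_diff_right inner_commute)
  qed
  have "w \<in> C + U\<^sup>\<bottom> \<longleftrightarrow> (\<forall>a\<in>\<pi> ` A. a \<bullet> w \<le> 0)" for w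
    using mem_cylinder_iff[OF assms(1,2) \<pi>(1) \<pi>(2)] A(2) adj by auto
  then have "C + U\<^sup>\<bottom> = {w. \<forall>a\<in>\<pi> ` A. a \<bullet> w \<le> 0}" by blast
  then show ?thesis using A(1) polyhedral_cone_halfspaces[of "\<pi> ` A"] by simp
qed

section \<open>Cone angles as combinations of point evaluations\<close>

lemma cone_angle_split:
  fixes a :: "'a::euclidean_space"
  assumes "cone_angle \<alpha>" "polyhedral_cone C" "a \<noteq> 0"
  shows "\<alpha> C = \<alpha> (C \<inter> {x. a \<bullet> x \<le> 0}) + \<alpha> (C \<inter> {x. a \<bullet> x \<ge> 0})"
proof -
  let ?C1 = "C \<inter> {x. a \<bullet> x \<le> 0}" and ?C2 = "C \<inter> {x. a \<bullet> x \<ge> 0}"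
  have "{x. a \<bullet> x \<ge> 0} = {x. \<forall>b\<in>{-a}. b \<bullet> x \<le> 0}" "{x. a \<bullet> x \<le> 0} = {x. \<forall>b\<in>{a}. b \<bullet> x \<le> 0}"
    by auto
  then have "polyhedral_cone {x. a \<bullet> x \<ge> 0}" "polyhedral_cone {x. a \<bullet> x \<le> 0}"
    using polyhedral_cone_halfspaces[of "{-a}"] polyhedral_cone_halfspaces[of "{a}"] by simp_all
  then have p: "polyhedral_cone ?C1" "polyhedral_cone ?C2"
    using assms(2) polyhedral_cone_Int by blast+
  \<comment> \<open>The common wall lies in a hyperplane, so the inclusion-exclusion term
    vanishes.\<close>
  have "aff_dim (?C1 \<inter> ?C2) \<le> aff_dim {x. a \<bullet> x = 0}" by (rule aff_dim_subset) auto
  also have "\<dots> < int DIM('a)" using assms(3) by simp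
  finally have "\<alpha> (?C1 \<inter> ?C2) = 0"
    using assms(1) polyhedral_cone_Int[OF p] by (simp add: cone_angle_def)
  moreover have un: "?C1 \<union> ?C2 = C" by auto
  then have "\<alpha> (?C1 \<union> ?C2) = \<alpha> ?C1 + \<alpha> ?C2 - \<alpha> (?C1 \<inter> ?C2)"
    using assms(1,2) p unfolding cone_angle_def by metis
  ultimately show ?thesis using un by simp
qed

text \<open>
  A cone angle is, on the cones cut out by finitely many hyperplanes, a signed combination of
  evaluations at points off these hyperplanes: one point per chamber.
\<close>

lemma cone_angle_samples_ex:
  fixes \<alpha> :: "'a::euclidean_space set \<Rightarrow> real"
  assumes \<alpha>: "cone_angle \<alpha>" and "finite A" "0 \<notin> A" "polyhedral_cone D"
  shows "\<exists>ws :: ('a \<times> real) list.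
    (\<forall>(w, t)\<in>set ws. w \<in> interior D \<and> (\<forall>a\<in>A. a \<bullet> w \<noteq> 0)) \<and>
    (\<forall>B\<subseteq>A. \<alpha> (D \<inter> {x. \<forall>a\<in>B. a \<bullet> x \<le> 0})
       = (\<Sum>(w, t)\<leftarrow>ws. if \<forall>a\<in>B. a \<bullet> w \<le> 0 then t else 0))"
  using assms(2-)
proof (induction A arbitrary: D rule: finite_induct)
  case empty
  show ?case
  proof (cases "interior D = {}")
    case True
    \<comment> \<open>A convex set without interior is lower-dimensional, so its angle is 0 and no
      sample is taken.\<close>
    have "convex D" using empty by (simp add: polyhedral_cone_def polyhedron_imp_convex)
    then have "rel_interior D \<noteq> {}"
      using empty by (auto simp: rel_interior_eq_empty polyhedral_cone_def convex_cone_def)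
    then have "aff_dim D \<noteq> int DIM('a)" using True interior_rel_interior[of D] by metis
    then have "aff_dim D < int DIM('a)" using aff_dim_le_DIM[of D] by linarith
    then have "\<alpha> D = 0" using \<alpha> empty by (simp add: cone_angle_def)
    then show ?thesis by (intro exI[of _ "[]"]) auto
  next
    case False
    then obtain w where "w \<in> interior D" by blast
    then show ?thesis by (intro exI[of _ "[(w, \<alpha> D)]"]) auto
  qed
next
  case (insert a A)
  let ?D1 = "D \<inter> {x. a \<bullet> x \<le> 0}" and ?D2 = "D \<inter> {x. a \<bullet> x \<ge> 0}"
  have a: "a \<noteq> 0" "-a \<noteq> 0" "0 \<notin> A" using insert by auto
  have h2: "{x. a \<bullet> x \<ge> 0} = {x. -a \<bullet> x \<le> 0}" by auto
  have hp: "polyhedral_cone {x. b \<bullet> x \<le> 0}" for b :: 'a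
    using polyhedral_cone_halfspaces[of "{b}"] by simp
  have p: "polyhedral_cone ?D1" "polyhedral_cone ?D2"
    unfolding h2 using insert.prems hp polyhedral_cone_Int by blast+
  obtain ws1 where ws1: "\<forall>(w, t)\<in>set ws1. w \<in> interior ?D1 \<and> (\<forall>a\<in>A. a \<bullet> w \<noteq> 0)"
    "\<forall>B\<subseteq>A. \<alpha> (?D1 \<inter> {x. \<forall>a\<in>B. a \<bullet> x \<le> 0}) = (\<Sum>(w, t)\<leftarrow>ws1. if \<forall>a\<in>B. a \<bullet> w \<le> 0 then t else 0)"
    using insert.IH[OF a(3) p(1)] by blast
  obtain ws2 where ws2: "\<forall>(w, t)\<in>set ws2. w \<in> interior ?D2 \<and> (\<forall>a\<in>A. a \<bullet> w \<noteq> 0)"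
    "\<forall>B\<subseteq>A. \<alpha> (?D2 \<inter> {x. \<forall>a\<in>B. a \<bullet> x \<le> 0}) = (\<Sum>(w, t)\<leftarrow>ws2. if \<forall>a\<in>B. a \<bullet> w \<le> 0 then t else 0)"
    using insert.IH[OF a(3) p(2)] by blast
  \<comment> \<open>Sampling in the interior of each half gives the strict sign of \<open>a\<close>,
    which keeps the new points off the new hyperplane.\<close>
  have i1: "w \<in> interior D \<and> a \<bullet> w < 0" if "w \<in> interior ?D1" for w
    using that a by (auto simp: interior_Int)
  have i2: "w \<in> interior D \<and> a \<bullet> w > 0" if "w \<in> interior ?D2" for w
    using that a unfolding h2 by (auto simp: interior_Int simp del: inner_minus_left) simp
  have s1: "a \<bullet> w < 0" if "(w, t) \<in> set ws1" for w t using ws1(1) i1 that by blast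
  have s2: "a \<bullet> w > 0" if "(w, t) \<in> set ws2" for w t using ws2(1) i2 that by blast
  have "\<alpha> (D \<inter> {x. \<forall>b\<in>B. b \<bullet> x \<le> 0})
      = (\<Sum>(w, t)\<leftarrow>ws1 @ ws2. if \<forall>b\<in>B. b \<bullet> w \<le> 0 then t else 0)" if B: "B \<subseteq> insert a A" for B
  proof (cases "a \<in> B")
    case True
    define B' where "B' = B - {a}"
    have B': "B' \<subseteq> A" "B = insert a B'" using B True by (auto simp: B'_def)
    have "D \<inter> {x. \<forall>b\<in>B. b \<bullet> x \<le> 0} = ?D1 \<inter> {x. \<forall>b\<in>B'. b \<bullet> x \<le> 0}"
      using B'(2) by auto
    then have "\<alpha> (D \<inter> {x. \<forall>b\<in>B. b \<bullet> x \<le> 0}) = (\<Sum>(w, t)\<leftarrow>ws1. if \<forall>a\<in>B'. a \<bullet> w \<le> 0 then t else 0)"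
      using ws1(2) B'(1) by simp
    also have "\<dots> = (\<Sum>(w, t)\<leftarrow>ws1. if \<forall>b\<in>B. b \<bullet> w \<le> 0 then t else 0)"
      by (intro arg_cong[where f = sum_list] map_cong) (auto simp: B'(2) dest: s1)
    moreover have "(\<Sum>(w, t)\<leftarrow>ws2. if \<forall>b\<in>B. b \<bullet> w \<le> 0 then t else 0) = (\<Sum>(w, t)\<leftarrow>ws2. 0)"
      using True by (intro arg_cong[where f = sum_list] map_cong) (fastforce dest: s2)+
    moreover have "(\<Sum>(w, t)\<leftarrow>ws2. (0::real)) = 0" by (induction ws2) auto
    ultimately show ?thesis by simp
  next
    case False
    then have "B \<subseteq> A" using B by blast
    have "polyhedral_cone {x. \<forall>b\<in>B. b \<bullet> x \<le> 0}"
      using \<open>B \<subseteq> A\<close> insert.hyps by (intro polyhedral_cone_halfspaces) (rule finite_subset)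
    then have "polyhedral_cone (D \<inter> {x. \<forall>b\<in>B. b \<bullet> x \<le> 0})"
      using insert.prems polyhedral_cone_Int by blast
    from cone_angle_split[OF \<alpha> this a(1)]
    have "\<alpha> (D \<inter> {x. \<forall>b\<in>B. b \<bullet> x \<le> 0})
        = \<alpha> (?D1 \<inter> {x. \<forall>b\<in>B. b \<bullet> x \<le> 0}) + \<alpha> (?D2 \<inter> {x. \<forall>b\<in>B. b \<bullet> x \<le> 0})"
      by (simp add: Int_ac)
    then show ?thesis using ws1(2) ws2(2) \<open>B \<subseteq> A\<close> by simp
  qed
  moreover have "\<forall>(w, t)\<in>set (ws1 @ ws2). w \<in> interior D \<and> (\<forall>b\<in>insert a A. b \<bullet> w \<noteq> 0)"
  proof -
    have "w \<in> interior D \<and> (\<forall>b\<in>insert a A. b \<bullet> w \<noteq> 0)" if "(w, t) \<in> set ws1 \<or> (w, t) \<in> set ws2" for w t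
      using that
    proof
      assume "(w, t) \<in> set ws1"
      then have "w \<in> interior ?D1" "\<forall>b\<in>A. b \<bullet> w \<noteq> 0" using ws1(1) by blast+
      then show ?thesis using i1[of w] by simp
    next
      assume "(w, t) \<in> set ws2"
      then have "w \<in> interior ?D2" "\<forall>b\<in>A. b \<bullet> w \<noteq> 0" using ws2(1) by blast+
      then show ?thesis using i2[of w] by simp
    qed
    then show ?thesis by (simp only: set_append Un_iff split_paired_all case_prod_conv Ball_def) blast
  qed
  ultimately show ?case by blast
qed

lemma sum_sum_list_swap:
  fixes f :: "'i \<Rightarrow> 'w \<Rightarrow> real"
  shows "(\<Sum>i\<in>I. k i * (\<Sum>w\<leftarrow>ws. f i w)) = (\<Sum>w\<leftarrow>ws. \<Sum>i\<in>I. k i * f i w)"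
  by (induction ws) (auto simp: distrib_left sum.distrib)

text \<open>Turns a linear relation between indicator functions into one between angles.
  \<open>B\<close> collects the normals of hyperplanes on which the relation may fail; one list of
  samples serves all cones and avoids these hyperplanes.\<close>

lemma cone_angle_sum_eq:
  fixes C :: "'i \<Rightarrow> 'a::euclidean_space set"
  assumes \<alpha>: "cone_angle \<alpha>" and I: "finite I" "\<And>i. i \<in> I \<Longrightarrow> polyhedral_cone (C i)"
    and B: "finite B" "0 \<notin> B"
    and eq: "\<And>w. \<forall>b\<in>B. b \<bullet> w \<noteq> 0 \<Longrightarrow> (\<Sum>i\<in>I. k i * (if w \<in> C i then 1 else 0)) = \<kappa>"
  shows "(\<Sum>i\<in>I. k i * \<alpha> (C i)) = \<kappa>"
proof -
  have "\<exists>A. finite A \<and> 0 \<notin> A \<and> C i = {x. \<forall>a\<in>A. a \<bullet> x \<le> 0}" if "i \<in> I" for i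
    by (rule polyhedral_cone_halfspaces_ex[OF I(2)[OF that]]) blast
  then have "\<forall>i\<in>I. \<exists>A. finite A \<and> 0 \<notin> A \<and> C i = {x. \<forall>a\<in>A. a \<bullet> x \<le> 0}" ..
  from bchoice[OF this] obtain H
    where H: "\<And>i. i \<in> I \<Longrightarrow> finite (H i) \<and> 0 \<notin> H i \<and> C i = {x. \<forall>a\<in>H i. a \<bullet> x \<le> 0}"
    by blast
  define A where "A = B \<union> (\<Union>i\<in>I. H i)"
  have A: "finite A" "0 \<notin> A" using H B I by (auto simp: A_def)
  obtain ws where ws: "\<forall>(w, t)\<in>set ws. w \<in> interior UNIV \<and> (\<forall>a\<in>A. a \<bullet> w \<noteq> 0)"
    "\<forall>B\<subseteq>A. \<alpha> (UNIV \<inter> {x. \<forall>a\<in>B. a \<bullet> x \<le> 0}) = (\<Sum>(w, t)\<leftarrow>ws. if \<forall>a\<in>B. a \<bullet> w \<le> 0 then t else 0)"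
    using cone_angle_samples_ex[OF \<alpha> A polyhedral_cone_UNIV] by blast
  \<comment> \<open>With no constraints the cone is the whole space, whose angle is 1. This lets the
    constant \<kappa> pass through unchanged.\<close>
  have one: "(\<Sum>(w, t)\<leftarrow>ws. t) = 1"
    using ws(2)[rule_format, of "{}"] \<alpha> by (simp add: cone_angle_def)
  have C: "\<alpha> (C i) = (\<Sum>p\<leftarrow>ws. snd p * (if fst p \<in> C i then 1 else 0))" if "i \<in> I" for i
  proof -
    have "\<alpha> (C i) = (\<Sum>(w, t)\<leftarrow>ws. if \<forall>a\<in>H i. a \<bullet> w \<le> 0 then t else 0)"
      using ws(2)[rule_format, of "H i"] H[OF that] that by (auto simp: A_def)
    also have "\<dots> = (\<Sum>p\<leftarrow>ws. snd p * (if fst p \<in> C i then 1 else 0))"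
      using H[OF that] by (intro arg_cong[where f = sum_list] map_cong) auto
    finally show ?thesis .
  qed
  have "(\<Sum>i\<in>I. k i * \<alpha> (C i)) = (\<Sum>p\<leftarrow>ws. \<Sum>i\<in>I. k i * (snd p * (if fst p \<in> C i then 1 else 0)))"
    using C by (simp add: sum_sum_list_swap)
  also have "\<dots> = (\<Sum>p\<leftarrow>ws. snd p * \<kappa>)"
  proof (intro arg_cong[where f = sum_list] map_cong refl)
    fix p assume "p \<in> set ws"
    then have "\<forall>b\<in>B. b \<bullet> fst p \<noteq> 0" using ws(1) by (auto simp: A_def)
    then show "(\<Sum>i\<in>I. k i * (snd p * (if fst p \<in> C i then 1 else 0))) = snd p * \<kappa>"
      using eq[of "fst p"] by (simp add: mult.left_commute[of _ "snd p"] flip: sum_distrib_left)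
  qed
  also have "\<dots> = (\<Sum>(w, t)\<leftarrow>ws. t) * \<kappa>"
  proof -
    have "(\<lambda>(w, t). t) = (snd :: 'a \<times> real \<Rightarrow> real)" by auto
    then show ?thesis by (simp add: sum_list_mult_const)
  qed
  finally show ?thesis using one by simp
qed

section \<open>The Euler relation for cells of a central arrangement\<close>

text \<open>The relatively open cells of the central arrangement with normals \<open>A\<close>, cut
  down to \<open>U\<close>. As an image of \<open>U\<close> the family contains no empty cell, so
  \<open>nat\<close> does not distort any dimension in the sums below.\<close>

definition sign_cells :: "'a::euclidean_space set \<Rightarrow> 'a set \<Rightarrow> 'a set set" where
  "sign_cells A U = (\<lambda>x. {y \<in> U. \<forall>a\<in>A. sgn (a \<bullet> y) = sgn (a \<bullet> x)}) ` U"

lemma sign_cells_insert: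
  "sign_cells (insert a A) U = sign_cells A (U \<inter> {x. a \<bullet> x > 0})
     \<union> sign_cells A (U \<inter> {x. a \<bullet> x = 0}) \<union> sign_cells A (U \<inter> {x. a \<bullet> x < 0})"
proof -
  let ?g = "\<lambda>x. {y \<in> U. \<forall>b\<in>insert a A. sgn (b \<bullet> y) = sgn (b \<bullet> x)}"
  have "?g ` (U \<inter> {x. a \<bullet> x > 0}) = sign_cells A (U \<inter> {x. a \<bullet> x > 0})"
    "?g ` (U \<inter> {x. a \<bullet> x = 0}) = sign_cells A (U \<inter> {x. a \<bullet> x = 0})"
    "?g ` (U \<inter> {x. a \<bullet> x < 0}) = sign_cells A (U \<inter> {x. a \<bullet> x < 0})"
    unfolding sign_cells_def by (intro image_cong; auto simp: sgn_if split: if_splits)+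
  moreover have "U = (U \<inter> {x. a \<bullet> x > 0}) \<union> (U \<inter> {x. a \<bullet> x = 0}) \<union> (U \<inter> {x. a \<bullet> x < 0})"
    by auto
  then have "?g ` U = ?g ` (U \<inter> {x. a \<bullet> x > 0}) \<union> ?g ` (U \<inter> {x. a \<bullet> x = 0}) \<union> ?g ` (U \<inter> {x. a \<bullet> x < 0})"
    by (metis image_Un)
  ultimately show ?thesis unfolding sign_cells_def[of "insert a A"] by simp
qed

lemma sign_cells_disjoint: "U \<inter> V = {} \<Longrightarrow> sign_cells A U \<inter> sign_cells A V = {}"
  by (auto simp: sign_cells_def)

lemma sign_cells_empty: "sign_cells A {} = {}"
  by (simp add: sign_cells_def)

lemma finite_sign_cells: "finite A \<Longrightarrow> finite (sign_cells A U)"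
proof (induction A arbitrary: U rule: finite_induct)
  case empty
  have "sign_cells {} U \<subseteq> {U}" by (auto simp: sign_cells_def)
  then show ?case by (rule finite_subset) simp
qed (simp add: sign_cells_insert)

lemma subspace_Int_open_both_sides:
  fixes S :: "'a::euclidean_space set"
  assumes "subspace S" "open T" "x \<in> S" "x \<in> T" "a \<bullet> x = 0" "s \<in> S" "a \<bullet> s > 0"
  obtains y z where "y \<in> S \<inter> T" "a \<bullet> y > 0" "z \<in> S \<inter> T" "a \<bullet> z < 0"
proof -
  obtain e where e: "e > 0" "ball x e \<subseteq> T" using assms open_contains_ball by blast
  have "s \<noteq> 0" using assms by auto
  define t where "t = e / (2 * norm s)"
  have t: "t > 0" "norm (t *\<^sub>R s) < e" using e \<open>s \<noteq> 0\<close> by (auto simp: t_def)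
  have "x + t *\<^sub>R s \<in> T" "x - t *\<^sub>R s \<in> T" using e t by (auto simp: dist_norm)
  moreover have "x + t *\<^sub>R s \<in> S" "x - t *\<^sub>R s \<in> S"
    using assms by (auto intro: subspace_add subspace_diff subspace_scale)
  ultimately show thesis
    using that[of "x + t *\<^sub>R s" "x - t *\<^sub>R s"] t assms by (simp add: inner_add_right inner_diff_right)
qed

text \<open>A new hyperplane may contain \<open>S\<close>, or miss \<open>S \<inter> T\<close> and
  leave only one side nonempty; neither changes the sum. Otherwise it cuts the set into two open
  pieces and a wall of one dimension less, and up to the common sign 1 + 1 - 1 = 1.\<close>

lemma sum_sign_cells:
  fixes A :: "'a::euclidean_space set"
  assumes "finite A" "subspace S" "open T" "convex T" "S \<inter> T \<noteq> {}"
  shows "(\<Sum>K\<in>sign_cells A (S \<inter> T). (-1) ^ nat (aff_dim K)) = (-1 :: real) ^ dim S"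
  using assms
proof (induction A arbitrary: S T rule: finite_induct)
  case empty
  have "sign_cells {} (S \<inter> T) = {S \<inter> T}" using empty by (auto simp: sign_cells_def)
  moreover have "aff_dim (S \<inter> T) = int (dim S)"
    using empty by (simp add: aff_dim_convex_Int_open subspace_imp_convex aff_dim_subspace)
  ultimately show ?case by simp
next
  case (insert a A)
  let ?f = "\<lambda>U. \<Sum>K\<in>sign_cells A U. (-1 :: real) ^ nat (aff_dim K)"
  define P where "P = T \<inter> {x. a \<bullet> x > 0}"
  define N where "N = T \<inter> {x. a \<bullet> x < 0}"
  define Z where "Z = S \<inter> {x. a \<bullet> x = 0}"
  have U: "S \<inter> T \<inter> {x. a \<bullet> x > 0} = S \<inter> P" "S \<inter> T \<inter> {x. a \<bullet> x = 0} = Z \<inter> T"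
    "S \<inter> T \<inter> {x. a \<bullet> x < 0} = S \<inter> N"
    by (auto simp: P_def N_def Z_def)
  have op: "open P" "convex P" "open N" "convex N"
    using insert.prems unfolding P_def N_def
    by (auto intro!: open_halfspace_gt open_halfspace_lt convex_halfspace_gt convex_halfspace_lt convex_Int)
  have Z: "subspace Z"
    unfolding Z_def using insert.prems by (simp add: subspace_inter subspace_hyperplane)
  have "(\<Sum>K\<in>sign_cells (insert a A) (S \<inter> T). (-1 :: real) ^ nat (aff_dim K)) = ?f (S \<inter> P) + ?f (Z \<inter> T) + ?f (S \<inter> N)"
    unfolding sign_cells_insert U
  proof (subst sum.union_disjoint)
    show "finite (sign_cells A (S \<inter> P) \<union> sign_cells A (Z \<inter> T))" "finite (sign_cells A (S \<inter> N))"
      using insert.hyps by (auto intro: finite_sign_cells)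
    have "S \<inter> P \<inter> (S \<inter> N) = {}" "Z \<inter> T \<inter> (S \<inter> N) = {}" by (auto simp: P_def N_def Z_def)
    then show "(sign_cells A (S \<inter> P) \<union> sign_cells A (Z \<inter> T)) \<inter> sign_cells A (S \<inter> N) = {}"
      using sign_cells_disjoint by (metis Int_Un_distrib2 Un_empty)
    have "S \<inter> P \<inter> (Z \<inter> T) = {}" by (auto simp: P_def N_def Z_def)
    then have "sign_cells A (S \<inter> P) \<inter> sign_cells A (Z \<inter> T) = {}" by (rule sign_cells_disjoint)
    then show "(\<Sum>K\<in>sign_cells A (S \<inter> P) \<union> sign_cells A (Z \<inter> T). (-1 :: real) ^ nat (aff_dim K)) + ?f (S \<inter> N)
      = ?f (S \<inter> P) + ?f (Z \<inter> T) + ?f (S \<inter> N)"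
      using insert.hyps by (simp add: sum.union_disjoint finite_sign_cells)
  qed
  also have "\<dots> = (-1) ^ dim S"
  proof (cases "S \<subseteq> {x. a \<bullet> x = 0}")
    case True
    then have "S \<inter> P = {}" "S \<inter> N = {}" "Z = S" by (auto simp: P_def N_def Z_def)
    then show ?thesis using insert by (simp add: sign_cells_empty)
  next
    case False
    then obtain s0 where s0: "s0 \<in> S" "a \<bullet> s0 \<noteq> 0" by blast
    then obtain s where s: "s \<in> S" "a \<bullet> s > 0"
      using subspace_neg[OF insert.prems(1) s0(1)]
      by (metis inner_minus_right linorder_neqE_linordered_idom neg_0_less_iff_less)
    have "0 \<in> Z" using Z subspace_0 by blast
    then have dZ: "int (dim Z) = int (dim S) - 1"
      using aff_dim_affine_Int_hyperplane[OF subspace_imp_affine[OF insert.prems(1)], of a 0] False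
      by (auto simp: aff_dim_subspace[OF Z] aff_dim_subspace[OF insert.prems(1)] simp flip: Z_def)
    then obtain n where n: "dim S = Suc n" "dim Z = n"
      by (cases "dim S") auto
    have fP: "?f (S \<inter> P) = (if S \<inter> P = {} then 0 else (-1) ^ dim S)"
      using insert.IH[OF insert.prems(1) op(1,2)] by (simp add: sign_cells_empty)
    have fN: "?f (S \<inter> N) = (if S \<inter> N = {} then 0 else (-1) ^ dim S)"
      using insert.IH[OF insert.prems(1) op(3,4)] by (simp add: sign_cells_empty)
    have fZ: "?f (Z \<inter> T) = (if Z \<inter> T = {} then 0 else (-1) ^ n)"
      using insert.IH[OF Z insert.prems(2,3)] n by (simp add: sign_cells_empty)
    show ?thesis
    proof (cases "Z \<inter> T = {}")
      case True
      have "S \<inter> P \<noteq> {} \<or> S \<inter> N \<noteq> {}"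
      proof -
        obtain x where x: "x \<in> S" "x \<in> T" using insert.prems(4) by blast
        then have "a \<bullet> x \<noteq> 0" using True by (auto simp: Z_def)
        then have "x \<in> S \<inter> P \<or> x \<in> S \<inter> N" using x by (auto simp: P_def N_def)
        then show ?thesis by blast
      qed
      moreover have "S \<inter> P = {} \<or> S \<inter> N = {}"
      proof (rule ccontr)
        assume "\<not> (S \<inter> P = {} \<or> S \<inter> N = {})"
        then obtain y z where yz: "y \<in> S \<inter> T" "a \<bullet> y > 0" "z \<in> S \<inter> T" "a \<bullet> z < 0"
          by (auto simp: P_def N_def)
        \<comment> \<open>The parameter at which the segment from \<open>y\<close> to
          \<open>z\<close> crosses the hyperplane.\<close>
        define u where "u = a \<bullet> y / (a \<bullet> y - a \<bullet> z)"
        have u: "0 \<le> u" "u \<le> 1" using yz by (auto simp: u_def)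
        have "convex (S \<inter> T)" using insert.prems by (simp add: convex_Int subspace_imp_convex)
        then have "(1 - u) *\<^sub>R y + u *\<^sub>R z \<in> S \<inter> T" using yz u by (auto simp: convex_alt)
        moreover have "a \<bullet> ((1 - u) *\<^sub>R y + u *\<^sub>R z) = a \<bullet> y - u * (a \<bullet> y - a \<bullet> z)"
          by (simp add: inner_add_right algebra_simps)
        moreover have "\<dots> = 0" using yz by (simp add: u_def)
        ultimately show False using True by (auto simp: Z_def)
      qed
      ultimately show ?thesis using fP fN fZ True by auto
    next
      case False
      then obtain x where x: "x \<in> S" "x \<in> T" "a \<bullet> x = 0" by (auto simp: Z_def)
      obtain y z where "y \<in> S \<inter> T" "a \<bullet> y > 0" "z \<in> S \<inter> T" "a \<bullet> z < 0"
        using subspace_Int_open_both_sides[OF insert.prems(1,2) x s] .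
      then have "S \<inter> P \<noteq> {}" "S \<inter> N \<noteq> {}" by (auto simp: P_def N_def)
      then show ?thesis using fP fN fZ False n by simp
    qed
  qed
  finally show ?case .
qed

section \<open>Belt polytopes\<close>

lemma belt_polytope_imp_polytope: "belt_polytope P \<Longrightarrow> polytope P"
  by (simp add: belt_polytope_def)

lemma belt_polytope_face:
  assumes "belt_polytope P" "G face_of P"
  shows "belt_polytope G"
proof -
  have "polytope G" using assms face_of_polytope_polytope by (auto simp: belt_polytope_def)
  moreover have "H face_of P" if "H face_of G" for H using that assms(2) by (rule face_of_trans)
  ultimately show ?thesis using assms(1) by (simp add: belt_polytope_def)
qed

lemma edge_of_trans: "E edge_of F \<Longrightarrow> F face_of G \<Longrightarrow> E edge_of G"
  by (auto simp: edge_of_def intro: face_of_trans)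

lemma edge_nonempty: "E edge_of G \<Longrightarrow> E \<noteq> {}"
  by (auto simp: edge_of_def)

text \<open>Here the belt condition on 2-faces enters, in the form in which the simplex step uses
  it.\<close>

lemma belt_2_face_parallel_edge_ex:
  assumes "belt_polytope G" "K face_of G" "aff_dim K = 2" "E edge_of K"
  obtains E' where "E' edge_of K" "lin_dir E' = lin_dir E" "E' \<noteq> E"
proof -
  obtain e and k :: nat where ek: "bij_betw e {..<2 * k} {E. E edge_of K}"
    "\<forall>i<k. lin_dir (e i) = lin_dir (e (i + k))"
    using assms(1-3) by (auto simp: belt_polytope_def edge_cycle_def)
  have "E \<in> e ` {..<2 * k}" using ek(1) assms(4) by (simp add: bij_betw_def)
  then obtain i where i: "i < 2 * k" "E = e i" by blast
  \<comment> \<open>The antipode is \<open>i + k\<close> modulo \<open>2 * k\<close>. Parallelism is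
    given for \<open>i < k\<close>, so for the second half of the indices it is read
    backwards.\<close>
  define j where "j = (if i < k then i + k else i - k)"
  have j: "j < 2 * k" "j \<noteq> i" using i by (auto simp: j_def)
  have "lin_dir (e j) = lin_dir E"
  proof (cases "i < k")
    case True
    then show ?thesis using ek(2) i by (simp add: j_def)
  next
    case False
    then have "j < k" "j + k = i" using i by (auto simp: j_def)
    then show ?thesis using ek(2) i by metis
  qed
  moreover have "e j \<noteq> E" using ek(1) i j by (auto simp: bij_betw_def inj_on_def)
  moreover have "e j \<in> e ` {..<2 * k}" using j by blast
  then have "e j edge_of K" using ek(1) by (simp add: bij_betw_def)
  ultimately show thesis using that by blast
qed

text \<open>Modulo the direction of \<open>E\<close> the plane of \<open>K\<close> is
  one-dimensional, so \<open>c\<close> and a functional \<open>h\<close> exposing \<open>E\<close>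
  are proportional there. As \<open>h\<close> pushes all of \<open>K\<close> to one side of
  \<open>E\<close>, every point of \<open>K\<close> off \<open>E\<close> improves \<open>c\<close>
  as soon as one does.\<close>

lemma parallel_edge_improves:
  fixes K :: "'a::euclidean_space set"
  assumes K: "polytope K" "aff_dim K = 2" and E: "E edge_of K" "E' edge_of K" "E' \<noteq> E"
    and c: "c \<in> (lin_dir E)\<^sup>\<bottom>" and x: "x \<in> E" and y: "y \<in> K" "c \<bullet> y > c \<bullet> x"
  obtains z where "z \<in> E'" "c \<bullet> z > c \<bullet> x"
proof -
  have EK: "E face_of K" "E' face_of K" "aff_dim E = 1" "aff_dim E' = 1" "E \<subseteq> K" "E' \<subseteq> K"
    using E by (auto simp: edge_of_def face_of_imp_subset)
  have "\<not> E' \<subseteq> E"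
  proof
    assume "E' \<subseteq> E"
    then have "E' face_of E" using EK by (metis face_of_subset)
    then show False
      using E(3) EK face_of_aff_dim_lt[of E E'] face_of_imp_convex by force
  qed
  then obtain z where z: "z \<in> E'" "z \<notin> E" by blast
  obtain h m where hm: "\<forall>x\<in>K. h \<bullet> x \<le> m" "K \<inter> {x. h \<bullet> x = m} = E"
    using exposing_functional_ex[OF K(1) EK(1)] by blast
  have hx: "h \<bullet> x = m" using hm(2) x by blast
  have "z \<in> K" using z EK by blast
  then have hz: "h \<bullet> (z - x) < 0"
    using hm z hx by (force simp: inner_diff_right order_less_le)
  have hy: "h \<bullet> (y - x) \<le> 0" using hm(1) y hx by (simp add: inner_diff_right)
  have cE: "c \<bullet> v = 0" if "v \<in> lin_dir E" for v
    using inner_orthogonal_comp[OF that c] by (simp add: inner_commute)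
  have "\<forall>u\<in>E. h \<bullet> u = h \<bullet> x" using hx by (auto simp flip: hm(2))
  then have "h \<in> (lin_dir E)\<^sup>\<bottom>" using orthogonal_lin_dir_iff[OF x] by blast
  then have hE: "h \<bullet> v = 0" if "v \<in> lin_dir E" for v
    using inner_orthogonal_comp[OF that] by (simp add: inner_commute)
  have ne: "E \<noteq> {}" "K \<noteq> {}" using x y by auto
  have sE: "subspace (lin_dir E)" "subspace (lin_dir K)" using ne subspace_lin_dir by blast+
  have spE: "span (lin_dir E) = lin_dir E" using sE(1) by simp
  have "y - x \<notin> lin_dir E" using cE[of "y - x"] y by (auto simp: inner_diff_right)
  \<comment> \<open>\<open>c\<close> separates \<open>y - x\<close> from the direction of
    \<open>E\<close>, so together they span the direction of \<open>K\<close>, and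
    \<open>z - x\<close> is a multiple of \<open>y - x\<close> up to a vector along
    \<open>E\<close>.\<close>
  then have "dim (insert (y - x) (lin_dir E)) = dim (lin_dir E) + 1"
    by (simp add: dim_insert spE)
  moreover have "int (dim (lin_dir E)) = 1" "int (dim (lin_dir K)) = 2"
    using EK K aff_dim_eq_dim_lin_dir ne by metis+
  ultimately have d: "dim (span (insert (y - x) (lin_dir E))) = dim (lin_dir K)" by simp
  have "x \<in> K" using x EK by blast
  have "span (insert (y - x) (lin_dir E)) \<subseteq> lin_dir K"
    using sE lin_dir_mono[OF EK(5)] diff_in_lin_dir[OF y(1) \<open>x \<in> K\<close>]
    by (intro span_minimal) auto
  then have "span (insert (y - x) (lin_dir E)) = lin_dir K"
    using d sE(2) by (intro subspace_dim_equal) auto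
  then have "z - x \<in> span (insert (y - x) (lin_dir E))"
    using diff_in_lin_dir[OF \<open>z \<in> K\<close> \<open>x \<in> K\<close>] by simp
  then obtain t where "z - x - t *\<^sub>R (y - x) \<in> lin_dir E"
    by (auto simp: span_breakdown_eq spE)
  from hE[OF this] cE[OF this]
  have t: "h \<bullet> (z - x) = t * (h \<bullet> (y - x))" "c \<bullet> (z - x) = t * (c \<bullet> (y - x))"
    by (simp_all add: inner_diff_right)
  have "t > 0"
  proof (rule ccontr)
    assume "\<not> t > 0"
    then have "t * (h \<bullet> (y - x)) \<ge> 0" using hy by (intro mult_nonpos_nonpos) auto
    then show False using t hz by simp
  qed
  then have "c \<bullet> (z - x) > 0" using t y by (simp add: inner_diff_right)
  then show thesis using that z by (simp add: inner_diff_right)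
qed

text \<open>Take the best of the finitely many edges parallel to \<open>E\<close>. Were it not
  optimal, an improving 2-face would contain a better parallel edge.\<close>

lemma belt_parallel_edge_in_max_face:
  fixes G :: "'a::euclidean_space set"
  assumes G: "belt_polytope G" and E: "E edge_of G" and c: "c \<in> (lin_dir E)\<^sup>\<bottom>"
  obtains E' where "E' edge_of G" "lin_dir E' = lin_dir E" "E' \<subseteq> max_face G c"
proof -
  define \<E> where "\<E> = {E'. E' edge_of G \<and> lin_dir E' = lin_dir E}"
  \<comment> \<open>\<open>c\<close> is constant on each of these edges, so the chosen point is
    immaterial.\<close>
  define val where "val = (\<lambda>E'. c \<bullet> (SOME x. x \<in> E'))"
  have val: "c \<bullet> x = val E'" if "E' \<in> \<E>" "x \<in> E'" for E' x
  proof -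
    have "(SOME x. x \<in> E') \<in> E'" using that(2) by (rule someI)
    moreover have "c \<in> (lin_dir E')\<^sup>\<bottom>" using c that by (simp add: \<E>_def)
    ultimately show ?thesis using that orthogonal_lin_dir_iff unfolding val_def by blast
  qed
  have pG: "polytope G" using G by (rule belt_polytope_imp_polytope)
  have fin: "finite \<E>"
    by (rule finite_subset[OF _ finite_polytope_faces[OF pG]]) (auto simp: \<E>_def edge_of_def)
  moreover have "\<E> \<noteq> {}" using E by (auto simp: \<E>_def)
  ultimately have "Max (val ` \<E>) \<in> val ` \<E>" by (intro Max_in) auto
  then obtain E1 where E1: "E1 \<in> \<E>" "val E1 = Max (val ` \<E>)" by (metis imageE)
  have max: "val E' \<le> val E1" if "E' \<in> \<E>" for E' unfolding E1(2) using fin that by simp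
  have E1G: "E1 face_of G" "aff_dim E1 = 1" "E1 edge_of G" "lin_dir E1 = lin_dir E"
    using E1 by (auto simp: \<E>_def edge_of_def)
  have "E1 \<subseteq> max_face G c"
  proof (rule ccontr)
    assume "\<not> E1 \<subseteq> max_face G c"
    then obtain x z where xz: "x \<in> E1" "z \<in> G" "c \<bullet> z > c \<bullet> x"
      using face_of_imp_subset[OF E1G(1)] by (force simp: max_face_def)
    have cv: "\<forall>u\<in>E1. c \<bullet> u = c \<bullet> x" using val E1(1) xz(1) by metis
    obtain K y where K: "K face_of G" "E1 \<subseteq> K" "aff_dim K = 2" "y \<in> K" "c \<bullet> y > c \<bullet> x"
      by (rule improving_face_ex[OF pG E1G(1) _ cv xz(2,3)]) (use xz E1G in auto)
    have pK: "polytope K" using pG K(1) by (rule face_of_polytope_polytope)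
    have "E1 edge_of K"
      using E1G K by (meson edge_of_def face_of_imp_subset face_of_subset)
    then obtain E2 where E2: "E2 edge_of K" "lin_dir E2 = lin_dir E1" "E2 \<noteq> E1"
      using belt_2_face_parallel_edge_ex[OF G K(1,3)] by blast
    have "c \<in> (lin_dir E1)\<^sup>\<bottom>" using c E1G by simp
    then obtain w where w: "w \<in> E2" "c \<bullet> w > c \<bullet> x"
      using parallel_edge_improves[OF pK K(3) \<open>E1 edge_of K\<close> E2(1,3) _ xz(1) K(4,5)] by blast
    have "E2 \<in> \<E>" using E2 E1G edge_of_trans[OF E2(1) K(1)] by (simp add: \<E>_def)
    then show False using w max val xz(1) E1(1) by force
  qed
  then show thesis using that E1G by blast
qed

text \<open>\<open>F\<close> need not be a face of \<open>G\<close>. Each edge of \<open>F\<close>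
  is transported twice: into a parallel edge of \<open>G\<close>, using a functional that exposes
  \<open>G\<close> in \<open>P\<close>, and from there, inside the belt polytope \<open>G\<close>,
  into the face maximising \<open>c\<close>. Edge directions suffice by
  \<open>lin_dir_subset_if_edges\<close>.\<close>

lemma belt_lin_dir_subset_max_face:
  fixes P :: "'a::euclidean_space set"
  assumes P: "belt_polytope P" and F: "F face_of P" "F \<noteq> {}" and G: "G face_of P"
    and sub: "lin_dir F \<subseteq> lin_dir G" and c: "c \<in> (lin_dir F)\<^sup>\<bottom>"
  shows "lin_dir F \<subseteq> lin_dir (max_face G c)"
proof -
  have pP: "polytope P" using P by (rule belt_polytope_imp_polytope)
  have pF: "polytope F" and pG: "polytope G" using pP F G face_of_polytope_polytope by blast+
  have Gne: "G \<noteq> {}" using sub F by (metis lin_dir_eq_empty_iff subset_empty)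
  have bG: "belt_polytope G" using P G by (rule belt_polytope_face)
  obtain g where g: "max_face P g = G" by (rule face_eq_max_face[OF pP G Gne])
  then have gG: "g \<in> (lin_dir G)\<^sup>\<bottom>" using max_face_orthogonal_lin_dir[of P g] Gne by simp
  show ?thesis
  proof (rule lin_dir_subset_if_edges[OF pF])
    show "subspace (lin_dir (max_face G c))"
      using max_face_nonempty[OF pG Gne] by (rule subspace_lin_dir)
    fix E assume E: "E edge_of F"
    then have EF: "lin_dir E \<subseteq> lin_dir F" by (intro lin_dir_mono edge_of_imp_subset)
    then have "g \<in> (lin_dir E)\<^sup>\<bottom>" using gG sub orthogonal_comp_anti_mono by blast
    then obtain E1 where E1: "E1 edge_of P" "lin_dir E1 = lin_dir E" "E1 \<subseteq> G"
      using belt_parallel_edge_in_max_face[OF P edge_of_trans[OF E F(1)]] g by metis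
    then have "E1 edge_of G"
      using G by (meson edge_of_def face_of_imp_subset face_of_subset)
    moreover have "c \<in> (lin_dir E1)\<^sup>\<bottom>" using c EF E1(2) orthogonal_comp_anti_mono by blast
    ultimately obtain E2 where "lin_dir E2 = lin_dir E1" "E2 \<subseteq> max_face G c"
      using belt_parallel_edge_in_max_face[OF bG] by metis
    then show "lin_dir E \<subseteq> lin_dir (max_face G c)" using lin_dir_mono E1(2) by metis
  qed
qed

text \<open>The normal fan of a belt polytope is the fan of a central hyperplane arrangement.\<close>

lemma belt_arrangement_ex:
  fixes G :: "'a::euclidean_space set"
  assumes G: "belt_polytope G" and ne: "G \<noteq> {}"
  obtains A where "finite A"
    "\<And>c c'. max_face G c = max_face G c' \<longleftrightarrow> (\<forall>a\<in>A. sgn (a \<bullet> c) = sgn (a \<bullet> c'))"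
    "\<And>a c. a \<in> A \<Longrightarrow> a \<bullet> c = 0 \<Longrightarrow> a \<in> lin_dir (max_face G c)"
proof -
  have pG: "polytope G" using G by (rule belt_polytope_imp_polytope)
  have "\<forall>E\<in>{E. E edge_of G}. \<exists>u. lin_dir E = span {u}"
  proof
    fix E assume "E \<in> {E. E edge_of G}"
    then have E: "E edge_of G" by simp
    then have s: "subspace (lin_dir E)" using edge_nonempty subspace_lin_dir by blast
    have d: "dim (lin_dir E) = 1"
      using aff_dim_eq_dim_lin_dir[OF edge_nonempty[OF E]] E by (simp add: edge_of_def)
    then obtain u where u: "u \<in> lin_dir E" "u \<noteq> 0"
      using dim_eq_0[of "lin_dir E"] by force
    have "span {u} = lin_dir E"
      using u s d by (intro subspace_dim_equal) (auto simp: span_minimal dim_span)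
    then show "\<exists>u. lin_dir E = span {u}" by metis
  qed
  from bchoice[OF this] obtain u where u: "\<And>E. E edge_of G \<Longrightarrow> lin_dir E = span {u E}" by blast
  \<comment> \<open>The normals of the arrangement are generators of the edge directions of
    \<open>G\<close>.\<close>
  define A where "A = u ` {E. E edge_of G}"
  have "finite {E. E edge_of G}"
    by (rule finite_subset[OF _ finite_polytope_faces[OF pG]]) (auto simp: edge_of_def)
  then have fin: "finite A" by (simp add: A_def)
  have in_dir: "a \<in> lin_dir (max_face G c)" if a: "a \<in> A" and "a \<bullet> c = 0" for a c
  proof -
    obtain E where E: "E edge_of G" "a = u E" using a by (auto simp: A_def)
    have "span {a} \<subseteq> {x. c \<bullet> x = 0}"
      using that(2) by (intro span_minimal subspace_hyperplane) (auto simp: inner_commute)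
    then have cE: "c \<in> (lin_dir E)\<^sup>\<bottom>"
      using u[OF E(1)] E(2) by (auto simp: orthogonal_comp_def orthogonal_def inner_commute)
    obtain E' where E': "lin_dir E' = lin_dir E" "E' \<subseteq> max_face G c"
      by (rule belt_parallel_edge_in_max_face[OF G E(1) cE])
    have "a \<in> lin_dir E'" using E' u[OF E(1)] E(2) by (simp add: span_base)
    then show ?thesis using lin_dir_mono[OF E'(2)] by blast
  qed
  \<comment> \<open>A vertex that is optimal for \<open>c\<close> but not for \<open>c'\<close> has
    an edge improving \<open>c'\<close>; equal signs on its direction make the same edge improve
    \<open>c\<close>.\<close>
  have sub: "max_face G c \<subseteq> max_face G c'" if sg: "\<forall>a\<in>A. sgn (a \<bullet> c) = sgn (a \<bullet> c')" for c c'
  proof (rule polytope_subset_convex_if_extreme_points)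
    have f: "max_face G c face_of G" "max_face G c' face_of G"
      using pG by (auto intro: max_face_face_of polytope_imp_convex)
    then show "polytope (max_face G c)" using pG face_of_polytope_polytope by blast
    show "convex (max_face G c')" using f face_of_imp_convex by blast
    fix v assume "v extreme_point_of max_face G c"
    then have v: "v extreme_point_of G" "v \<in> max_face G c"
      using f extreme_point_of_face by blast+
    show "v \<in> max_face G c'"
    proof (rule ccontr)
      assume "v \<notin> max_face G c'"
      then obtain z where z: "z \<in> G" "c' \<bullet> z > c' \<bullet> v"
        using v(2) by (force simp: max_face_def)
      have vf: "{v} face_of G" using v by (simp add: face_of_singleton)
      obtain K y where K: "K face_of G" "{v} \<subseteq> K" "aff_dim K = aff_dim {v} + 1" "y \<in> K" "c' \<bullet> y > c' \<bullet> v"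
        by (rule improving_face_ex[OF pG vf _ _ z]) auto
      have KE: "K edge_of G" using K by (simp add: edge_of_def)
      have "y - v \<in> span {u K}" using K diff_in_lin_dir[of y K v] u[OF KE] by auto
      then obtain t where t: "y - v = t *\<^sub>R u K" by (auto simp: span_singleton)
      have "t * (u K \<bullet> c') > 0"
        using K(5) t by (metis diff_gt_0_iff_gt inner_commute inner_diff_left inner_scaleR_left)
      moreover have "u K \<in> A" using KE by (auto simp: A_def)
      then have "sgn (u K \<bullet> c) = sgn (u K \<bullet> c')" using sg by blast
      then have "sgn (t * (u K \<bullet> c)) = sgn (t * (u K \<bullet> c'))" by (simp add: sgn_mult)
      ultimately have "t * (u K \<bullet> c) > 0" by (metis sgn_1_pos)
      then have "c \<bullet> y > c \<bullet> v"
        using t by (metis diff_gt_0_iff_gt inner_commute inner_diff_left inner_scaleR_left)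
      moreover have "y \<in> G" using K face_of_imp_subset by blast
      ultimately show False using v(2) by (force simp: max_face_def)
    qed
  qed
  have zero: "a \<bullet> c = 0" if "a \<in> lin_dir (max_face G c)" for a c
    using inner_orthogonal_comp[OF that max_face_orthogonal_lin_dir[OF max_face_nonempty[OF pG ne]]] .
  have "sgn (a \<bullet> c) = sgn (a \<bullet> c')" if eq: "max_face G c = max_face G c'" and a: "a \<in> A" for a c c'
  proof (rule ccontr)
    assume neq: "sgn (a \<bullet> c) \<noteq> sgn (a \<bullet> c')"
    \<comment> \<open>Vanishing of a normal on \<open>c\<close> means that its direction lies in
      that of the maximal face, a property of the face alone.\<close>
    have iff: "a \<bullet> c = 0 \<longleftrightarrow> a \<bullet> c' = 0" using in_dir[OF a] zero eq by metis
    \<comment> \<open>For opposite signs these weights give a positive combination orthogonal to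
      \<open>a\<close> with the same maximal face. Then \<open>a\<close> would lie in the direction
      of that face and vanish on \<open>c\<close>.\<close>
    define s where "s = \<bar>a \<bullet> c'\<bar>"
    define t where "t = \<bar>a \<bullet> c\<bar>"
    have nz: "a \<bullet> c \<noteq> 0" "a \<bullet> c' \<noteq> 0" using neq iff by auto
    have st: "s > 0" "t > 0" using nz by (auto simp: s_def t_def)
    have "s * (a \<bullet> c) + t * (a \<bullet> c') = 0"
      using neq nz by (auto simp: s_def t_def sgn_if abs_if split: if_splits)
    then have "a \<bullet> (s *\<^sub>R c + t *\<^sub>R c') = 0" by (simp add: inner_add_right)
    then have "a \<in> lin_dir (max_face G (s *\<^sub>R c + t *\<^sub>R c'))" by (rule in_dir[OF a])
    moreover have "max_face G (s *\<^sub>R c + t *\<^sub>R c') = max_face G c"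
      using max_face_add[OF _ st, of G c c'] max_face_nonempty[OF pG ne] eq by simp
    ultimately show False using zero nz by metis
  qed
  then have "max_face G c = max_face G c' \<longleftrightarrow> (\<forall>a\<in>A. sgn (a \<bullet> c) = sgn (a \<bullet> c'))" for c c'
    using sub[of c c'] sub[of c' c] by (metis subset_antisym)
  then show thesis using that[OF fin] in_dir by blast
qed

section \<open>The Euler relation for faces of a belt polytope\<close>

lemma dim_orthogonal_comp:
  fixes U :: "'a::euclidean_space set"
  assumes "subspace U"
  shows "dim (U\<^sup>\<bottom>) + dim U = DIM('a)"
  using dim_subspace_orthogonal_to_vectors[OF assms subspace_UNIV]
  by (simp add: orthogonal_comp_def dim_UNIV)

text \<open>The functionals in \<open>U\<close> exposing \<open>J\<close> form one cell of the
  arrangement, and its dimension is complementary to that of \<open>J\<close>. So this is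
  \<open>sum_sign_cells\<close> on the orthogonal complement of the flat, with signs dualised. The
  belt property keeps the cells of \<open>J\<close> inside that complement.\<close>

lemma belt_euler_relation:
  fixes P :: "'a::euclidean_space set"
  assumes P: "belt_polytope P" and F: "F face_of P" "F \<noteq> {}" and G: "G face_of P"
    and sub: "lin_dir F \<subseteq> lin_dir G"
    and T: "open T" "convex T" "(lin_dir F)\<^sup>\<bottom> \<inter> T \<noteq> {}"
  shows "(\<Sum>J\<in>max_face G ` ((lin_dir F)\<^sup>\<bottom> \<inter> T). (-1) ^ nat (aff_dim J)) = (-1 :: real) ^ dim (lin_dir F)"
proof -
  define L where "L = lin_dir F"
  define U where "U = L\<^sup>\<bottom> \<inter> T"
  define cell where "cell = (\<lambda>J. {y \<in> U. max_face G y = J})"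
  have sL: "subspace L" unfolding L_def using F(2) by (rule subspace_lin_dir)
  have Gne: "G \<noteq> {}" using sub F by (metis lin_dir_eq_empty_iff subset_empty)
  have bG: "belt_polytope G" using P G by (rule belt_polytope_face)
  have pG: "polytope G" using bG by (rule belt_polytope_imp_polytope)
  obtain A where A: "finite A"
    "\<And>c c'. max_face G c = max_face G c' \<longleftrightarrow> (\<forall>a\<in>A. sgn (a \<bullet> c) = sgn (a \<bullet> c'))"
    "\<And>a c. a \<in> A \<Longrightarrow> a \<bullet> c = 0 \<Longrightarrow> a \<in> lin_dir (max_face G c)"
    using belt_arrangement_ex[OF bG Gne] by blast
  have cells: "sign_cells A U = cell ` (max_face G ` U)"
    unfolding sign_cells_def cell_def image_image A(2) ..
  have inj: "inj_on cell (max_face G ` U)"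
    by (rule inj_onI) (force simp: cell_def)
  have dimJ: "aff_dim (cell J) = int DIM('a) - aff_dim J" "aff_dim J \<ge> 0" if J: "J \<in> max_face G ` U" for J
  proof -
    obtain x where x: "x \<in> U" "J = max_face G x" using J by blast
    have Jne: "J \<noteq> {}" using x max_face_nonempty[OF pG Gne] by simp
    have sJ: "subspace (lin_dir J)" using Jne by (rule subspace_lin_dir)
    have xL: "x \<in> L\<^sup>\<bottom>" using x by (simp add: U_def)
    have LJ: "L \<subseteq> lin_dir J"
      using belt_lin_dir_subset_max_face[OF P F G sub] xL x(2) by (simp add: L_def)
    \<comment> \<open>\<open>W\<close> keeps the open conditions: \<open>T\<close> and the strict
      signs at \<open>x\<close>. Normals vanishing on \<open>x\<close> lie in the direction of
      \<open>J\<close>, so they vanish on all of its orthogonal complement; the cell is therefore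
      relatively open there and has full dimension.\<close>
    define W where "W = T \<inter> (\<Inter>a\<in>{a\<in>A. a \<bullet> x \<noteq> 0}. {y. sgn (a \<bullet> x) * (a \<bullet> y) > 0})"
    have "open W"
      unfolding W_def using A(1) T
      by (intro open_Int open_INT ballI)
         (auto intro!: open_Collect_less continuous_intros)
    have sgn_iff: "sgn (a \<bullet> y) = sgn (a \<bullet> x) \<longleftrightarrow> sgn (a \<bullet> x) * (a \<bullet> y) > 0" if "a \<bullet> x \<noteq> 0" for a y
      using that by (auto simp: sgn_if)
    have "cell J = (lin_dir J)\<^sup>\<bottom> \<inter> W"
    proof (intro equalityI subsetI)
      fix y assume y: "y \<in> cell J"
      then have "y \<in> (lin_dir J)\<^sup>\<bottom>"
        using max_face_orthogonal_lin_dir[of G y] Jne by (auto simp: cell_def)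
      moreover have "sgn (a \<bullet> y) = sgn (a \<bullet> x)" if "a \<in> A" for a
        using y A(2)[of y x] x(2) that by (auto simp: cell_def)
      ultimately show "y \<in> (lin_dir J)\<^sup>\<bottom> \<inter> W"
        using y sgn_iff by (auto simp: cell_def W_def U_def)
    next
      fix y assume y: "y \<in> (lin_dir J)\<^sup>\<bottom> \<inter> W"
      have "sgn (a \<bullet> y) = sgn (a \<bullet> x)" if a: "a \<in> A" for a
      proof (cases "a \<bullet> x = 0")
        case True
        then have "a \<in> lin_dir J" using A(3)[OF a] x(2) by simp
        then show ?thesis using True inner_orthogonal_comp[of a "lin_dir J" y] y by simp
      next
        case False
        then show ?thesis using y a sgn_iff by (auto simp: W_def)
      qed
      then have "max_face G y = J" using A(2)[of y x] x(2) by simp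
      moreover have "y \<in> U" using y orthogonal_comp_anti_mono[OF LJ] by (auto simp: U_def W_def)
      ultimately show "y \<in> cell J" by (simp add: cell_def)
    qed
    moreover have "cell J \<noteq> {}" using x by (auto simp: cell_def)
    ultimately have "aff_dim (cell J) = aff_dim ((lin_dir J)\<^sup>\<bottom>)"
      using \<open>open W\<close> by (simp add: aff_dim_convex_Int_open subspace_imp_convex subspace_orthogonal_comp)
    also have "\<dots> = int (dim ((lin_dir J)\<^sup>\<bottom>))"
      by (simp add: aff_dim_subspace subspace_orthogonal_comp)
    finally show "aff_dim (cell J) = int DIM('a) - aff_dim J"
      using dim_orthogonal_comp[OF sJ] aff_dim_eq_dim_lin_dir[OF Jne] by linarith
    show "aff_dim J \<ge> 0" using aff_dim_eq_dim_lin_dir[OF Jne] by simp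
  qed
  have "(\<Sum>J\<in>max_face G ` U. (-1 :: real) ^ nat (aff_dim (cell J))) = (\<Sum>K\<in>sign_cells A U. (-1) ^ nat (aff_dim K))"
    unfolding cells by (simp add: sum.reindex[OF inj])
  also have "\<dots> = (-1) ^ dim (L\<^sup>\<bottom>)"
    unfolding U_def using A(1) T by (intro sum_sign_cells) (auto simp: subspace_orthogonal_comp L_def)
  finally have *: "(\<Sum>J\<in>max_face G ` U. (-1 :: real) ^ nat (aff_dim (cell J))) = (-1) ^ dim (L\<^sup>\<bottom>)" .
  \<comment> \<open>The dimensions of \<open>J\<close> and of its cell add up to that of the space,
    so their signs differ by a global factor.\<close>
  have "(-1 :: real) ^ nat (aff_dim J) = (-1) ^ DIM('a) * (-1) ^ nat (aff_dim (cell J))" if "J \<in> max_face G ` U" for J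
  proof -
    have "aff_dim J \<le> int DIM('a)" by (rule aff_dim_le_DIM)
    then have "DIM('a) = nat (aff_dim J) + nat (aff_dim (cell J))" using dimJ[OF that] by linarith
    then have "(-1 :: real) ^ DIM('a) * (-1) ^ nat (aff_dim (cell J))
      = (-1) ^ nat (aff_dim J) * ((-1) ^ nat (aff_dim (cell J)) * (-1) ^ nat (aff_dim (cell J)))"
      by (metis mult.assoc power_add)
    then show ?thesis by (simp flip: power_mult_distrib)
  qed
  then have "(\<Sum>J\<in>max_face G ` U. (-1 :: real) ^ nat (aff_dim J)) = (-1) ^ DIM('a) * (-1) ^ dim (L\<^sup>\<bottom>)"
    using * by (simp flip: sum_distrib_left)
  also have "\<dots> = (-1) ^ dim L * ((-1) ^ dim (L\<^sup>\<bottom>) * (-1) ^ dim (L\<^sup>\<bottom>))"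
    using dim_orthogonal_comp[OF sL] by (metis add.commute mult.assoc power_add)
  also have "\<dots> = (-1) ^ dim L" by (simp flip: power_mult_distrib)
  finally show ?thesis by (simp add: U_def L_def)
qed

section \<open>Angle sums over parallel faces\<close>

lemma normal_cone_eq:
  "F \<subseteq> G \<Longrightarrow> normal_cone F G = {c. F \<subseteq> max_face G c}"
  by (auto simp: normal_cone_def max_face_def)

lemma normal_cone_orthogonal:
  assumes "F \<subseteq> G" "F \<noteq> {}"
  shows "normal_cone F G \<subseteq> (lin_dir F)\<^sup>\<bottom>"
proof
  fix c assume "c \<in> normal_cone F G"
  then have sub: "F \<subseteq> max_face G c" using normal_cone_eq[OF assms(1)] by blast
  then have "c \<in> (lin_dir (max_face G c))\<^sup>\<bottom>"
    using assms(2) by (intro max_face_orthogonal_lin_dir) auto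
  then show "c \<in> (lin_dir F)\<^sup>\<bottom>"
    using orthogonal_comp_anti_mono[OF lin_dir_mono[OF sub]] by blast
qed

text \<open>The inequalities are linear in both points, so comparing pairs of generators suffices
  and finitely many half-spaces remain.\<close>

lemma polyhedral_cone_normal_cone:
  assumes "polytope F" "polytope G"
  shows "polyhedral_cone (normal_cone F G)"
proof -
  obtain V W where V: "finite V" "F = convex hull V" and W: "finite W" "G = convex hull W"
    using assms by (auto simp: polytope_def)
  define A where "A = (\<lambda>(x, y). y - x) ` (V \<times> W)"
  have "normal_cone F G = {c. \<forall>a\<in>A. a \<bullet> c \<le> 0}"
  proof (intro equalityI subsetI)
    fix c assume "c \<in> normal_cone F G"
    then show "c \<in> {c. \<forall>a\<in>A. a \<bullet> c \<le> 0}"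
      using V W by (auto simp: normal_cone_def A_def inner_diff_right inner_commute[of _ c] hull_inc)
  next
    fix c assume "c \<in> {c. \<forall>a\<in>A. a \<bullet> c \<le> 0}"
    then have c: "c \<bullet> y \<le> c \<bullet> x" if "x \<in> V" "y \<in> W" for x y
      using that by (force simp: A_def inner_diff_right inner_commute[of _ c])
    have "G \<subseteq> {y. c \<bullet> y \<le> c \<bullet> x}" if "x \<in> V" for x
      unfolding W(2) using c[OF that] by (intro hull_minimal convex_halfspace_le) auto
    then have "F \<subseteq> {x. c \<bullet> x \<ge> c \<bullet> y}" if "y \<in> G" for y
      unfolding V(2) using that by (intro hull_minimal convex_halfspace_ge) auto
    then show "c \<in> normal_cone F G" by (auto simp: normal_cone_def)
  qed
  moreover have "finite A" using V W by (simp add: A_def)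
  ultimately show ?thesis using polyhedral_cone_halfspaces by simp
qed

lemma tangent_cone_subset_lin_dir:
  assumes "q \<in> G"
  shows "tangent_cone q G \<subseteq> lin_dir G"
  unfolding tangent_cone_def
proof (rule hull_minimal)
  show "(\<lambda>x. - q + x) ` G \<subseteq> lin_dir G" using diff_in_lin_dir[OF _ assms] by auto
  show "convex_cone (lin_dir G)"
    using assms by (intro subspace_imp_convex_cone subspace_lin_dir) auto
qed

lemma polyhedral_cone_tangent_cone: "polytope G \<Longrightarrow> polyhedral_cone (tangent_cone q G)"
  unfolding polyhedral_cone_def tangent_cone_def
  by (intro conjI convex_cone_convex_cone_hull polyhedron_convex_cone_hull_polytope polytope_translation_eq[THEN iffD2])

text \<open>Polarity of tangent and normal cone, stated with the functionals exposing exactly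
  \<open>J\<close>, because these make up a single cell of the fan. A violated inequality of the
  tangent cone may expose a larger face; a small multiple of a functional exposing \<open>J\<close>
  corrects this.\<close>

lemma in_tangent_cone_iff:
  fixes G :: "'a::euclidean_space set"
  assumes G: "polytope G" and J: "J face_of G" and q: "q \<in> rel_interior J"
  shows "p \<in> tangent_cone q G \<longleftrightarrow> (\<forall>c. max_face G c = J \<longrightarrow> c \<bullet> p \<le> 0)"
proof (intro iffI allI impI)
  have qJ: "q \<in> J" using q rel_interior_subset by blast
  fix c assume p: "p \<in> tangent_cone q G" and c: "max_face G c = J"
  have "tangent_cone q G \<subseteq> {x. c \<bullet> x \<le> 0}"
    unfolding tangent_cone_def
    using c qJ by (intro hull_minimal convex_cone_halfspace_le) (auto simp: max_face_def inner_diff_right)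
  then show "c \<bullet> p \<le> 0" using p by blast
next
  assume *: "\<forall>c. max_face G c = J \<longrightarrow> c \<bullet> p \<le> 0"
  have qJ: "q \<in> J" using q rel_interior_subset by blast
  then have qG: "q \<in> G" using J face_of_imp_subset by blast
  show "p \<in> tangent_cone q G"
  proof (rule ccontr)
    assume np: "p \<notin> tangent_cone q G"
    obtain A where A: "tangent_cone q G = {x. \<forall>a\<in>A. a \<bullet> x \<le> 0}"
      by (rule polyhedral_cone_halfspaces_ex[OF polyhedral_cone_tangent_cone[OF G]])
    obtain a where a: "a \<in> A" "a \<bullet> p > 0" using np A by force
    have "- q + x \<in> tangent_cone q G" if "x \<in> G" for x
      unfolding tangent_cone_def using that by (intro hull_inc) blast
    then have "a \<bullet> (- q + x) \<le> 0" if "x \<in> G" for x using that A a(1) by blast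
    then have "q \<in> max_face G a" using qG by (auto simp: max_face_def inner_diff_right)
    moreover have "J \<subseteq> G" using J face_of_imp_subset by blast
    ultimately have Ja: "J \<subseteq> max_face G a"
      using q max_face_face_of[OF polytope_imp_convex[OF G]]
      by (intro subset_of_face_of[of "max_face G a" G J]) auto
    obtain c where c: "max_face G c = J" by (rule face_eq_max_face[OF G J]) (use qJ in auto)
    \<comment> \<open>So small that the correction costs at most half of the positive value at
      \<open>p\<close>; the summand 1 keeps the denominator positive.\<close>
    define s where "s = a \<bullet> p / 2 / (\<bar>c \<bullet> p\<bar> + 1)"
    have s: "s > 0" using a by (simp add: s_def)
    have "max_face G (1 *\<^sub>R a + s *\<^sub>R c) = max_face G a \<inter> max_face G c"
      using Ja c qJ s by (intro max_face_add) auto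
    also have "\<dots> = J" using Ja c by blast
    finally have "(1 *\<^sub>R a + s *\<^sub>R c) \<bullet> p \<le> 0" using * by blast
    then have "a \<bullet> p \<le> - s * (c \<bullet> p)" by (simp add: inner_add_left)
    also have "\<dots> \<le> s * \<bar>c \<bullet> p\<bar>"
      using s mult_left_mono[OF abs_ge_minus_self[of "c \<bullet> p"], of s] by simp
    also have "\<dots> \<le> s * (\<bar>c \<bullet> p\<bar> + 1)" using s by simp
    also have "\<dots> = a \<bullet> p / 2"
    proof -
      have "\<bar>c \<bullet> p\<bar> + 1 \<noteq> 0" by linarith
      then show ?thesis unfolding s_def by (rule nonzero_eq_divide_eq[THEN iffD1]) (rule refl)
    qed
    finally show False using a by simp
  qed
qed

text \<open>The cylinders of the faces of \<open>G\<close> parallel to \<open>E\<close> cover each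
  generic \<open>w\<close> exactly once: by the one face that maximises the projection
  \<open>c\<close> of \<open>w\<close>.\<close>

lemma exterior_angle_sum:
  fixes P :: "'a::euclidean_space set"
  assumes \<alpha>: "cone_angle \<alpha>" and P: "belt_polytope P" and E: "E face_of P" "E \<noteq> {}"
    and G: "G face_of P" and sub: "lin_dir E \<subseteq> lin_dir G"
  shows "(\<Sum>F | F face_of G \<and> lin_dir F = lin_dir E. \<alpha> (normal_cone F G + lin_dir E)) = 1"
proof -
  define L where "L = lin_dir E"
  define I where "I = {F. F face_of G \<and> lin_dir F = L}"
  define S where "S = {J. J face_of G \<and> L \<subset> lin_dir J}"
  have sL: "subspace L" unfolding L_def using E(2) by (rule subspace_lin_dir)
  have LL: "L\<^sup>\<bottom>\<^sup>\<bottom> = L" using sL by (rule orthogonal_comp_self)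
  have Gne: "G \<noteq> {}" using sub E by (metis lin_dir_eq_empty_iff subset_empty)
  have pG: "polytope G" using P G belt_polytope_imp_polytope face_of_polytope_polytope by blast
  have fin: "finite {F. F face_of G}" using pG by (rule finite_polytope_faces)
  have Ine: "F \<noteq> {}" if "F \<in> I" for F
    using that sL by (metis (mono_tags) I_def lin_dir_eq_empty_iff mem_Collect_eq subspace_0 empty_iff)
  have Isub: "F \<subseteq> G" if "F \<in> I" for F using that by (simp add: I_def face_of_imp_subset)
  have Iorth: "normal_cone F G \<subseteq> L\<^sup>\<bottom>" if "F \<in> I" for F
    using normal_cone_orthogonal[OF Isub[OF that] Ine[OF that]] that by (simp add: I_def)
  \<comment> \<open>One hyperplane for each face whose direction is strictly too large. Off these
    hyperplanes the maximal face has direction exactly \<open>L\<close>, not merely containing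
    it.\<close>
  have "\<forall>J\<in>S. \<exists>b. b \<in> lin_dir J \<and> b \<in> L\<^sup>\<bottom> \<and> b \<noteq> 0"
  proof
    fix J assume J: "J \<in> S"
    then have "L \<subset> lin_dir J" by (simp add: S_def)
    moreover have "subspace (lin_dir J)"
      using J sL by (intro subspace_lin_dir) (auto simp: S_def lin_dir_empty)
    ultimately show "\<exists>b. b \<in> lin_dir J \<and> b \<in> L\<^sup>\<bottom> \<and> b \<noteq> 0"
      using psubset_subspace_orthogonal_ex[OF sL] by blast
  qed
  from bchoice[OF this] obtain b where b: "\<And>J. J \<in> S \<Longrightarrow> b J \<in> lin_dir J \<and> b J \<in> L\<^sup>\<bottom> \<and> b J \<noteq> 0"
    by blast
  have "(\<Sum>F\<in>I. 1 * \<alpha> (normal_cone F G + L)) = 1"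
  proof (rule cone_angle_sum_eq[OF \<alpha>, where B = "b ` S"])
    show fI: "finite I" "finite (b ` S)" using fin by (auto simp: I_def S_def)
    show "0 \<notin> b ` S" using b by force
    show "polyhedral_cone (normal_cone F G + L)" if F: "F \<in> I" for F
    proof -
      have "polytope F" using pG F face_of_polytope_polytope by (auto simp: I_def)
      then have "polyhedral_cone (normal_cone F G + L\<^sup>\<bottom>\<^sup>\<bottom>)"
        using pG by (intro polyhedral_cone_cylinder subspace_orthogonal_comp Iorth[OF F] polyhedral_cone_normal_cone)
      then show ?thesis by (simp only: LL)
    qed
    fix w assume w: "\<forall>b'\<in>b ` S. b' \<bullet> w \<noteq> 0"
    obtain c where c: "c \<in> L\<^sup>\<bottom>" "w - c \<in> L\<^sup>\<bottom>\<^sup>\<bottom>" by (rule proj_ex[OF subspace_orthogonal_comp])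
    define J where "J = max_face G c"
    have J: "J face_of G" unfolding J_def using pG by (intro max_face_face_of polytope_imp_convex)
    have Jne: "J \<noteq> {}" unfolding J_def using pG Gne by (rule max_face_nonempty)
    have LJ: "L \<subseteq> lin_dir J"
      unfolding L_def J_def using c(1) by (intro belt_lin_dir_subset_max_face[OF P E G sub]) (simp add: L_def)
    have "lin_dir J = L"
    proof (rule ccontr)
      assume "lin_dir J \<noteq> L"
      then have "J \<in> S" using LJ J by (auto simp: S_def)
      have "c \<in> (lin_dir J)\<^sup>\<bottom>" using max_face_orthogonal_lin_dir[of G c] Jne by (simp add: J_def)
      then have "b J \<bullet> c = 0" using b[OF \<open>J \<in> S\<close>] inner_orthogonal_comp by blast
      moreover have "b J \<bullet> (w - c) = 0" using b[OF \<open>J \<in> S\<close>] inner_orthogonal_comp[OF _ c(2)] by blast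
      ultimately have "b J \<bullet> w = 0" by (simp add: inner_diff_right)
      then show False using w \<open>J \<in> S\<close> by blast
    qed
    then have JI: "J \<in> I" using J by (simp add: I_def)
    have iff: "w \<in> normal_cone F G + L \<longleftrightarrow> F = J" if F: "F \<in> I" for F
    proof -
      have "w \<in> normal_cone F G + L \<longleftrightarrow> c \<in> normal_cone F G"
        using mem_cylinder_iff[OF subspace_orthogonal_comp Iorth[OF F] c] by (simp only: LL)
      also have "\<dots> \<longleftrightarrow> F \<subseteq> J" using normal_cone_eq[OF Isub[OF F]] by (simp add: J_def)
      also have "\<dots> \<longleftrightarrow> F = J"
      proof
        assume "F \<subseteq> J"
        have "J \<subseteq> G" using J by (rule face_of_imp_subset)
        have "F face_of J"
          by (rule face_of_subset[OF _ \<open>F \<subseteq> J\<close> \<open>J \<subseteq> G\<close>]) (use F in \<open>simp add: I_def\<close>)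
        have "convex J" using J face_of_imp_convex by blast
        then show "F = J"
          using \<open>F face_of J\<close> by (rule face_eq_if_lin_dir_eq) (use F \<open>lin_dir J = L\<close> in \<open>auto simp: I_def\<close>)
      qed simp
      finally show ?thesis .
    qed
    have "(\<Sum>F\<in>I. 1 * (if w \<in> normal_cone F G + L then 1 else 0)) = (\<Sum>F\<in>I. if F = J then 1 else (0::real))"
      using iff by (intro sum.cong) auto
    also have "\<dots> = 1" using fI(1) JI by simp
    finally show "(\<Sum>F\<in>I. 1 * (if w \<in> normal_cone F G + L then 1 else 0)) = (1::real)" .
  qed
  then show ?thesis by (simp add: I_def L_def)
qed

text \<open>Gram's relation for the projection of \<open>G\<close> along \<open>lin_dir E\<close>.\<close>

lemma interior_angle_sum:
  fixes P :: "'a::euclidean_space set"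
  assumes \<alpha>: "cone_angle \<alpha>" and P: "belt_polytope P" and E: "E face_of P" "E \<noteq> {}"
    and G: "G face_of P" and sub: "lin_dir E \<subset> lin_dir G"
  shows "(\<Sum>J | J face_of G \<and> lin_dir E \<subseteq> lin_dir J. (-1) ^ nat (aff_dim J)
      * \<alpha> (tangent_cone (SOME q. q \<in> rel_interior J) G + (lin_dir G)\<^sup>\<bottom>)) = 0"
proof -
  define L where "L = lin_dir E"
  define I where "I = {J. J face_of G \<and> L \<subseteq> lin_dir J}"
  define T where "T = (\<lambda>J. tangent_cone (SOME q. q \<in> rel_interior J) G)"
  have sL: "subspace L" unfolding L_def using E(2) by (rule subspace_lin_dir)
  have zL: "0 \<in> L" using sL by (rule subspace_0)
  have subL: "L \<subset> lin_dir G" using sub by (simp add: L_def)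
  have Gne: "G \<noteq> {}" using sub by (auto simp: lin_dir_empty)
  have sG: "subspace (lin_dir G)" using Gne by (rule subspace_lin_dir)
  have pG: "polytope G" using P G belt_polytope_imp_polytope face_of_polytope_polytope by blast
  have fI: "finite I"
    by (rule finite_subset[OF _ finite_polytope_faces[OF pG]]) (auto simp: I_def)
  have q: "(SOME q. q \<in> rel_interior J) \<in> rel_interior J" if "J \<in> I" for J
  proof -
    have "J \<noteq> {}" using that zL by (auto simp: I_def lin_dir_empty)
    moreover have "convex J" using that face_of_imp_convex by (auto simp: I_def)
    ultimately have "rel_interior J \<noteq> {}" using rel_interior_eq_empty by blast
    then show ?thesis by (simp add: some_in_eq)
  qed
  have Tsub: "T J \<subseteq> lin_dir G" if "J \<in> I" for J
  proof -
    have "J \<subseteq> G" using that by (simp add: I_def face_of_imp_subset)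
    then show ?thesis
      unfolding T_def using subsetD[OF rel_interior_subset q[OF that]]
      by (intro tangent_cone_subset_lin_dir) blast
  qed
  have Tiff: "p \<in> T J \<longleftrightarrow> (\<forall>c. max_face G c = J \<longrightarrow> c \<bullet> p \<le> 0)" if "J \<in> I" for J p
    unfolding T_def using that by (intro in_tangent_cone_iff[OF pG _ q[OF that]]) (simp add: I_def)
  have orth: "c \<in> L\<^sup>\<bottom>" if "max_face G c \<in> I" for c
    using that max_face_orthogonal_lin_dir[OF max_face_nonempty[OF pG Gne]] orthogonal_comp_anti_mono
    by (auto simp: I_def)
  have face: "max_face G c \<in> I" if "c \<in> L\<^sup>\<bottom>" for c
    using belt_lin_dir_subset_max_face[OF P E G psubset_imp_subset[OF sub]] that
      max_face_face_of[OF polytope_imp_convex[OF pG]]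
    by (simp add: I_def L_def)
  \<comment> \<open>The index set consists of the faces exposed by functionals orthogonal to
    \<open>L\<close>; that such functionals expose no other face is the belt property.\<close>
  have Ieq: "I = max_face G ` (L\<^sup>\<bottom> \<inter> UNIV)"
  proof (intro equalityI subsetI)
    fix J assume J: "J \<in> I"
    have "J face_of G" "J \<noteq> {}" using J zL by (auto simp: I_def lin_dir_empty)
    then obtain c where "max_face G c = J" by (rule face_eq_max_face[OF pG])
    then show "J \<in> max_face G ` (L\<^sup>\<bottom> \<inter> UNIV)" using J orth by blast
  qed (use face in auto)
  \<comment> \<open>Excluding the hyperplane orthogonal to \<open>b\<close> guarantees that the
    half-space \<open>H\<close> below meets the orthogonal complement of \<open>L\<close>.\<close>
  obtain b where b: "b \<in> lin_dir G" "b \<in> L\<^sup>\<bottom>" "b \<noteq> 0"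
    by (rule psubset_subspace_orthogonal_ex[OF sL sG subL])
  have "(\<Sum>J\<in>I. (-1) ^ nat (aff_dim J) * \<alpha> (T J + (lin_dir G)\<^sup>\<bottom>)) = 0"
  proof (rule cone_angle_sum_eq[OF \<alpha> fI, where B = "{b}"])
    show "finite {b}" "0 \<notin> {b}" using b by auto
    show "polyhedral_cone (T J + (lin_dir G)\<^sup>\<bottom>)" if "J \<in> I" for J
      unfolding T_def
      by (intro polyhedral_cone_cylinder sG polyhedral_cone_tangent_cone pG Tsub[OF that, unfolded T_def])
    fix w assume "\<forall>b'\<in>{b}. b' \<bullet> w \<noteq> 0"
    then have bw: "b \<bullet> w \<noteq> 0" by simp
    obtain p where p: "p \<in> lin_dir G" "w - p \<in> (lin_dir G)\<^sup>\<bottom>" by (rule proj_ex[OF sG])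
    define H where "H = {c. p \<bullet> c > 0}"
    have "b \<bullet> p \<noteq> 0" using inner_orthogonal_comp[OF b(1) p(2)] bw by (simp add: inner_diff_right)
    then have "b \<in> H \<or> - b \<in> H" by (auto simp: H_def inner_commute)
    moreover have "- b \<in> L\<^sup>\<bottom>" using b(2) by (simp add: subspace_neg subspace_orthogonal_comp)
    ultimately have Hne: "L\<^sup>\<bottom> \<inter> H \<noteq> {}" using b(2) by blast
    have H: "open H" "convex H" unfolding H_def
      by (auto intro: open_halfspace_gt convex_halfspace_gt)
    \<comment> \<open>The faces exposed by some functional positive on \<open>p\<close>: by duality,
      those whose tangent cone misses \<open>p\<close>. Both Euler relations have the same value, so
      the complement \<open>I - I'\<close> sums to 0.\<close>
    define I' where "I' = max_face G ` (L\<^sup>\<bottom> \<inter> H)"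
    have II: "I' \<subseteq> I" using face by (auto simp: I'_def)
    have sI: "(\<Sum>J\<in>I. (-1 :: real) ^ nat (aff_dim J)) = (-1) ^ dim L"
      unfolding Ieq L_def
      by (rule belt_euler_relation[OF P E G psubset_imp_subset[OF sub]])
         (use subspace_0[OF subspace_orthogonal_comp] in auto)
    have sI': "(\<Sum>J\<in>I'. (-1 :: real) ^ nat (aff_dim J)) = (-1) ^ dim L"
      unfolding I'_def L_def
      by (rule belt_euler_relation[OF P E G psubset_imp_subset[OF sub] H Hne[unfolded L_def]])
    have mem: "w \<in> T J + (lin_dir G)\<^sup>\<bottom> \<longleftrightarrow> J \<notin> I'" if J: "J \<in> I" for J
    proof -
      have "w \<in> T J + (lin_dir G)\<^sup>\<bottom> \<longleftrightarrow> p \<in> T J" by (rule mem_cylinder_iff[OF sG Tsub[OF J] p])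
      also have "\<dots> \<longleftrightarrow> (\<forall>c. max_face G c = J \<longrightarrow> c \<bullet> p \<le> 0)" by (rule Tiff[OF J])
      also have "\<dots> \<longleftrightarrow> J \<notin> I'"
        using orth J by (force simp: I'_def H_def inner_commute not_le)
      finally show ?thesis .
    qed
    have "(\<Sum>J\<in>I. (-1) ^ nat (aff_dim J) * (if w \<in> T J + (lin_dir G)\<^sup>\<bottom> then 1 else 0))
        = (\<Sum>J\<in>I - I'. (-1 :: real) ^ nat (aff_dim J))"
      using fI mem by (intro sum.mono_neutral_cong_right) auto
    also have "\<dots> = 0" using sI sI' by (simp add: sum_diff[OF fI II])
    finally show "(\<Sum>J\<in>I. (-1) ^ nat (aff_dim J) * (if w \<in> T J + (lin_dir G)\<^sup>\<bottom> then 1 else 0)) = (0::real)" .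
  qed
  then show ?thesis by (simp add: I_def L_def T_def)
qed

section \<open>Pushforward to the lattice of flats\<close>

text \<open>The hypothesis says that the zeta function times \<open>g\<close> is the delta at
  \<open>y\<close>; multiplication by the Moebius function from the left isolates
  \<open>g\<close>.\<close>

lemma moebius_fun_unique:
  fixes Q :: "'p::order set"
  assumes Q: "finite Q" and x: "x \<in> Q" and y: "y \<in> Q"
    and g: "\<And>z. z \<in> Q \<Longrightarrow> (\<Sum>t | t \<in> Q \<and> z \<le> t. g t) = (if z = y then 1 else 0)"
  shows "g x = moebius_fun Q x y"
proof -
  have zero: "moebius_fun Q x z = 0" if "\<not> x \<le> z" for z
    using that by (subst moebius_fun.simps) simp
  have inv: "(\<Sum>z\<in>Q. moebius_fun Q x z * zeta_fun Q z t) = (if x = t then 1 else 0)" if "t \<in> Q" for t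
  proof -
    have "(\<Sum>z\<in>Q. moebius_fun Q x z * zeta_fun Q z t)
        = (\<Sum>z \<in> {z \<in> Q. x \<le> z \<and> z \<le> t}. moebius_fun Q x z * zeta_fun Q z t)"
      using Q zero by (intro sum.mono_neutral_right) (auto simp: zeta_fun_def)
    then show ?thesis using moebius_fun_convolution_zeta_fun[OF Q x that] by simp
  qed
  have up: "(\<Sum>t\<in>Q. zeta_fun Q z t * g t) = (if z = y then 1 else 0)" if "z \<in> Q" for z
  proof -
    have "(\<Sum>t\<in>Q. zeta_fun Q z t * g t) = (\<Sum>t | t \<in> Q \<and> z \<le> t. g t)"
      using Q that by (intro sum.mono_neutral_cong_right) (auto simp: zeta_fun_def)
    then show ?thesis using g[OF that] by simp
  qed
  have "moebius_fun Q x y = (\<Sum>z\<in>Q. moebius_fun Q x z * (if z = y then 1 else 0))"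
    using Q y by (simp add: if_distrib cong: if_cong)
  also have "\<dots> = (\<Sum>z\<in>Q. moebius_fun Q x z * (\<Sum>t\<in>Q. zeta_fun Q z t * g t))"
    using up by (intro sum.cong) auto
  also have "\<dots> = (\<Sum>z\<in>Q. \<Sum>t\<in>Q. moebius_fun Q x z * zeta_fun Q z t * g t)"
    by (simp add: sum_distrib_left mult.assoc)
  also have "\<dots> = (\<Sum>t\<in>Q. (\<Sum>z\<in>Q. moebius_fun Q x z * zeta_fun Q z t) * g t)"
    by (subst sum.swap) (simp add: sum_distrib_right)
  also have "\<dots> = (\<Sum>t\<in>Q. (if x = t then 1 else 0) * g t)"
    using inv by (intro sum.cong) auto
  also have "\<dots> = g x" using Q x by (simp add: if_distrib[of "\<lambda>u. u * _"] cong: if_cong)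
  finally show ?thesis by simp
qed

lemma moebius_fun_eq_0: "\<not> (x \<in> Q \<and> y \<in> Q) \<Longrightarrow> moebius_fun Q x y = 0"
  by (subst moebius_fun.simps) auto

lemma compatible_if_fiber_sums:
  assumes "h \<in> incidence_algebra P"
    and "\<And>p' q. p' \<in> P \<Longrightarrow> q \<in> Q \<Longrightarrow> (\<Sum>p \<in> {p \<in> P. \<phi> p = q}. h p p') = k q (\<phi> p')"
  shows "h \<in> compatible_incidence_algebra P Q \<phi>"
  using assms by (auto simp: compatible_incidence_algebra_def)

text \<open>A fibre sum depending on \<open>p'\<close> only through its image is constant over the
  second fibre, so averaging returns it.\<close>

lemma pushforward_if_fiber_sums:
  assumes P: "finite P" and Q: "Q = \<phi> ` P"
    and k: "\<And>p' q. p' \<in> P \<Longrightarrow> q \<in> Q \<Longrightarrow> (\<Sum>p \<in> {p \<in> P. \<phi> p = q}. h p p') = k q (\<phi> p')"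
    and k0: "\<And>q q'. \<not> (q \<in> Q \<and> q' \<in> Q) \<Longrightarrow> k q q' = 0"
  shows "pushforward P \<phi> h = k"
proof (intro ext)
  fix q q'
  let ?A = "\<lambda>q. {p \<in> P. \<phi> p = q}"
  show "pushforward P \<phi> h q q' = k q q'"
  proof (cases "q \<in> Q \<and> q' \<in> Q")
    case False
    \<comment> \<open>Off the image a fibre is empty, the double sum is 0, and \<open>k0\<close>
      makes \<open>k\<close> agree, also where the average divides by 0.\<close>
    then have "?A q = {} \<or> ?A q' = {}" using Q by auto
    then show ?thesis using k0[OF False] by (auto simp only: pushforward_def sum.empty sum.neutral_const)
  next
    case True
    have "(\<Sum>p\<in>?A q. \<Sum>p'\<in>?A q'. h p p') = (\<Sum>p'\<in>?A q'. \<Sum>p\<in>?A q. h p p')"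
      by (rule sum.swap)
    also have "\<dots> = (\<Sum>p'\<in>?A q'. k q q')"
      using k True by (intro sum.cong) auto
    also have "\<dots> = real (card (?A q')) * k q q'" by simp
    finally have eq: "(\<Sum>p\<in>?A q. \<Sum>p'\<in>?A q'. h p p') = real (card (?A q')) * k q q'" .
    have "?A q' \<noteq> {}" "finite (?A q')" using True Q P by auto
    then have "card (?A q') \<noteq> 0" by (metis card_0_eq)
    then show ?thesis unfolding pushforward_def eq by simp
  qed
qed

section \<open>Fibre sums of the two angle functions\<close>

lemma finite_face_lattice: "belt_polytope P \<Longrightarrow> finite (face_lattice P)"
  by (simp add: face_lattice_def finite_polytope_faces belt_polytope_imp_polytope)

lemma exterior_angle_fiber_sum:
  fixes P :: "'a::euclidean_space set"
  assumes P: "belt_polytope P" and \<alpha>: "cone_angle \<alpha>"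
    and G: "G \<in> face_lattice P" and q: "q \<in> flats0 P"
  shows "(\<Sum>F \<in> {F \<in> face_lattice P. lin_dir F = q}. exterior_angle \<alpha> P F G) = zeta_fun (flats0 P) q (lin_dir G)"
proof -
  have GP: "G face_of P" using G by (simp add: face_lattice_def)
  have Gq: "lin_dir G \<in> flats0 P" using G by (simp add: flats0_eq_image)
  obtain E where E: "E face_of P" "q = lin_dir E"
    using q by (auto simp: flats0_eq_image face_lattice_def)
  show ?thesis
  proof (cases "E = {}")
    case True
    \<comment> \<open>Only the empty face lies over the empty flat, and its exterior angle is 1 by
      definition.\<close>
    have "{F \<in> face_lattice P. lin_dir F = q} = {{}}"
      using E True by (auto simp: lin_dir_empty lin_dir_eq_empty_iff face_lattice_def)
    then show ?thesis
      using q Gq E True GP by (simp add: exterior_angle_def zeta_fun_def lin_dir_empty)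
  next
    case False
    have "(\<Sum>F \<in> {F \<in> face_lattice P. lin_dir F = q}. exterior_angle \<alpha> P F G)
        = (\<Sum>F | F face_of G \<and> lin_dir F = lin_dir E. \<alpha> (normal_cone F G + lin_dir E))"
    proof (rule sum.mono_neutral_cong_right)
      show "finite {F \<in> face_lattice P. lin_dir F = q}" using finite_face_lattice[OF P] by simp
      show "{F. F face_of G \<and> lin_dir F = lin_dir E} \<subseteq> {F \<in> face_lattice P. lin_dir F = q}"
        using E GP by (auto simp: face_lattice_def intro: face_of_trans)
      show "\<forall>F\<in>{F \<in> face_lattice P. lin_dir F = q} - {F. F face_of G \<and> lin_dir F = lin_dir E}.
          exterior_angle \<alpha> P F G = 0"
        using E face_of_face[OF GP] by (auto simp: face_lattice_def exterior_angle_def)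
      show "exterior_angle \<alpha> P F G = \<alpha> (normal_cone F G + lin_dir E)"
        if "F \<in> {F. F face_of G \<and> lin_dir F = lin_dir E}" for F
        using that False face_of_face[OF GP] GP lin_dir_eq_empty_iff[of E]
        by (auto simp: exterior_angle_def lin_dir_empty)
    qed
    also have "\<dots> = zeta_fun (flats0 P) q (lin_dir G)"
    proof (cases "lin_dir E \<subseteq> lin_dir G")
      case True
      then show ?thesis
        using exterior_angle_sum[OF \<alpha> P E(1) False GP True] q Gq E by (simp add: zeta_fun_def)
    next
      case nsub: False
      then have "{F. F face_of G \<and> lin_dir F = lin_dir E} = {}"
        using lin_dir_mono face_of_imp_subset by blast
      then show ?thesis using nsub E by (simp only: sum.empty) (simp add: zeta_fun_def)
    qed
    finally show ?thesis .
  qed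
qed

text \<open>Duality for \<open>J = G\<close>: functionals exposing all of \<open>G\<close> vanish on
  its direction.\<close>

lemma tangent_cone_self:
  fixes G :: "'a::euclidean_space set"
  assumes "polytope G" "q \<in> rel_interior G"
  shows "tangent_cone q G = lin_dir G"
proof
  have qG: "q \<in> G" using assms rel_interior_subset by blast
  then show "tangent_cone q G \<subseteq> lin_dir G" by (rule tangent_cone_subset_lin_dir)
  have "p \<in> tangent_cone q G" if p: "p \<in> lin_dir G" for p
  proof -
    have "c \<bullet> p \<le> 0" if "max_face G c = G" for c
    proof -
      have "c \<in> (lin_dir G)\<^sup>\<bottom>" using max_face_orthogonal_lin_dir[of G c] that qG by auto
      then show ?thesis using inner_orthogonal_comp[OF p] by (simp add: inner_commute)
    qed
    moreover have "G face_of G" using assms polytope_imp_convex face_of_refl by blast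
    ultimately show ?thesis using in_tangent_cone_iff[OF assms(1) _ assms(2)] by blast
  qed
  then show "lin_dir G \<subseteq> tangent_cone q G" by blast
qed

lemma interior_angle_refl:
  fixes P :: "'a::euclidean_space set"
  assumes "cone_angle \<alpha>" "polytope P" "G face_of P" "G \<noteq> {}"
  shows "interior_angle \<alpha> P G G = 1"
proof -
  have pG: "polytope G" using assms face_of_polytope_polytope by blast
  have "rel_interior G \<noteq> {}" using assms(4) pG rel_interior_eq_empty polytope_imp_convex by blast
  then have "(SOME q. q \<in> rel_interior G) \<in> rel_interior G" by (simp add: some_in_eq)
  then have "tangent_cone (SOME q. q \<in> rel_interior G) G + (lin_dir G)\<^sup>\<bottom> = UNIV"
    using tangent_cone_self[OF pG] subspace_sum_orthogonal_comp[OF subspace_lin_dir[OF assms(4)]] by simp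
  then show ?thesis using assms by (simp add: interior_angle_def cone_angle_def)
qed

lemma minus_one_powi_diff: "(-1 :: real) powi (int a - int b) = (-1) ^ a * (-1) ^ b"
  by (simp add: power_int_diff) (cases "even b"; simp)

text \<open>Summing over all flats above a given one, instead of over one fibre, is the form in
  which Gram's relation becomes the Moebius recursion. Below the flat of \<open>G\<close> it yields
  0, and at that flat only \<open>G\<close> itself remains.\<close>

lemma signed_interior_angle_upper_sum_nonempty:
  fixes P :: "'a::euclidean_space set"
  assumes P: "belt_polytope P" and \<alpha>: "cone_angle \<alpha>"
    and GP: "G face_of P" and E: "E face_of P" "E \<noteq> {}"
  shows "(\<Sum>F | F \<in> face_lattice P \<and> lin_dir E \<subseteq> lin_dir F. signed_interior_angle \<alpha> P F G)
    = (if lin_dir E = lin_dir G then 1 else 0)"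
proof -
  let ?I = "{F. F face_of G \<and> lin_dir E \<subseteq> lin_dir F}"
  have pP: "polytope P" using P by (rule belt_polytope_imp_polytope)
  have pG: "polytope G" using pP GP by (rule face_of_polytope_polytope)
  have zE: "0 \<in> lin_dir E" using E by (simp add: zero_in_lin_dir_iff)
  have mono: "lin_dir F \<subseteq> lin_dir G" if "F \<in> ?I" for F
    using that lin_dir_mono face_of_imp_subset by blast
  have "(\<Sum>F | F \<in> face_lattice P \<and> lin_dir E \<subseteq> lin_dir F. signed_interior_angle \<alpha> P F G)
      = (\<Sum>F\<in>?I. signed_interior_angle \<alpha> P F G)"
  proof (rule sum.mono_neutral_right)
    show "finite {F. F \<in> face_lattice P \<and> lin_dir E \<subseteq> lin_dir F}" using finite_face_lattice[OF P] by simp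
    show "?I \<subseteq> {F. F \<in> face_lattice P \<and> lin_dir E \<subseteq> lin_dir F}"
      using GP by (auto simp: face_lattice_def intro: face_of_trans)
    show "\<forall>F\<in>{F. F \<in> face_lattice P \<and> lin_dir E \<subseteq> lin_dir F} - ?I. signed_interior_angle \<alpha> P F G = 0"
      using face_of_face[OF GP] by (auto simp: face_lattice_def signed_interior_angle_def interior_angle_def)
  qed
  also have "\<dots> = (if lin_dir E = lin_dir G then 1 else 0)"
  proof -
    consider "\<not> lin_dir E \<subseteq> lin_dir G" | "lin_dir E = lin_dir G" | "lin_dir E \<subset> lin_dir G" by blast
    then show ?thesis
    proof cases
      case 1
      then have "?I = {}" using mono by blast
      then show ?thesis using 1 by (simp only: sum.empty) auto
    next
      case 2
      have "F = G" if "F \<in> ?I" for F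
        by (rule face_eq_if_lin_dir_eq) (use that mono[OF that] 2 pG polytope_imp_convex in auto)
      moreover have "G \<in> ?I" using 2 pG face_of_refl polytope_imp_convex by auto
      ultimately have "?I = {G}" by blast
      moreover have "G \<noteq> {}" using 2 zE by (auto simp: lin_dir_empty)
      ultimately show ?thesis
        using 2 interior_angle_refl[OF \<alpha> pP GP] by (simp add: signed_interior_angle_def)
    next
      case 3
      have "(\<Sum>F\<in>?I. signed_interior_angle \<alpha> P F G)
          = (\<Sum>F\<in>?I. (-1) ^ nat (aff_dim G) * ((-1) ^ nat (aff_dim F)
              * \<alpha> (tangent_cone (SOME q. q \<in> rel_interior F) G + (lin_dir G)\<^sup>\<bottom>)))"
      proof (rule sum.cong[OF refl])
        fix F assume F: "F \<in> ?I"
        then have FG: "F face_of P" "F \<subseteq> G" "F \<noteq> {}"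
          using face_of_face[OF GP] zE by (auto simp: lin_dir_empty)
        then have "G \<noteq> {}" by auto
        then have "(-1 :: real) powi (aff_dim G - aff_dim F) = (-1) ^ nat (aff_dim G) * (-1) ^ nat (aff_dim F)"
          using FG(3) by (simp add: aff_dim_eq_dim_lin_dir minus_one_powi_diff)
        then show "signed_interior_angle \<alpha> P F G = (-1) ^ nat (aff_dim G) * ((-1) ^ nat (aff_dim F)
              * \<alpha> (tangent_cone (SOME q. q \<in> rel_interior F) G + (lin_dir G)\<^sup>\<bottom>))"
          using FG GP by (simp add: signed_interior_angle_def interior_angle_def)
      qed
      also have "\<dots> = 0"
        using interior_angle_sum[OF \<alpha> P E GP 3] by (simp flip: sum_distrib_left)
      finally show ?thesis using 3 by auto
    qed
  qed
  finally show ?thesis .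
qed

lemma signed_interior_angle_upper_sum:
  fixes P :: "'a::euclidean_space set"
  assumes P: "belt_polytope P" and \<alpha>: "cone_angle \<alpha>"
    and GP: "G face_of P" and z: "z \<in> flats0 P"
  shows "(\<Sum>F | F \<in> face_lattice P \<and> z \<subseteq> lin_dir F. signed_interior_angle \<alpha> P F G)
    = (if z = lin_dir G then 1 else 0)"
proof (cases "z = {}")
  case False
  then obtain E where "E face_of P" "E \<noteq> {}" "z = lin_dir E" using z by (auto simp: flats0_def)
  then show ?thesis using signed_interior_angle_upper_sum_nonempty[OF P \<alpha> GP] by simp
next
  case True
  let ?N = "face_lattice P - {{}}"
  have "{F. F \<in> face_lattice P \<and> z \<subseteq> lin_dir F} = face_lattice P" "{} \<in> face_lattice P"
    using True by (auto simp: face_lattice_def)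
  then have "(\<Sum>F | F \<in> face_lattice P \<and> z \<subseteq> lin_dir F. signed_interior_angle \<alpha> P F G)
      = signed_interior_angle \<alpha> P {} G + (\<Sum>F\<in>?N. signed_interior_angle \<alpha> P F G)"
    using sum.remove[OF finite_face_lattice[OF P]] by simp
  also have "\<dots> = (if z = lin_dir G then 1 else 0)"
  proof (cases "G = {}")
    case Ge: True
    have "(\<Sum>F\<in>?N. signed_interior_angle \<alpha> P F G) = 0"
      using Ge by (intro sum.neutral) (auto simp: signed_interior_angle_def interior_angle_def)
    then show ?thesis
      using Ge True by (simp add: signed_interior_angle_def interior_angle_def lin_dir_empty)
  next
    case Gne: False
    have pP: "polytope P" using P by (rule belt_polytope_imp_polytope)
    have "P \<noteq> {}" using Gne GP by auto
    \<comment> \<open>A vertex has direction \<open>{0}\<close>, which lies in every nonempty flat;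
      so the previous lemma at this vertex sums over all nonempty faces, and the empty face cancels
      the result.\<close>
    then obtain v where "v extreme_point_of P"
      using extreme_point_exists_convex[OF polytope_imp_compact[OF pP] polytope_imp_convex[OF pP]] by blast
    then have v: "{v} face_of P" by (simp add: face_of_singleton)
    have dv: "lin_dir {v} = {0}" by (simp add: lin_dir_def)
    have "?N = {F. F \<in> face_lattice P \<and> lin_dir {v} \<subseteq> lin_dir F}"
      unfolding dv by (auto simp: zero_in_lin_dir_iff)
    then have "(\<Sum>F\<in>?N. signed_interior_angle \<alpha> P F G) = (if {0} = lin_dir G then 1 else 0)"
      using signed_interior_angle_upper_sum_nonempty[OF P \<alpha> GP v] dv by simp
    moreover have "{0} = lin_dir G \<longleftrightarrow> aff_dim G \<le> 0"
      using Gne zero_in_lin_dir_iff[of G] by (auto simp: aff_dim_eq_dim_lin_dir dim_eq_0)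
    moreover have "signed_interior_angle \<alpha> P {} G = (if aff_dim G \<le> 0 then - 1 else 0)"
    proof (cases "aff_dim G \<le> 0")
      case dim: True
      \<comment> \<open>For a vertex \<open>G\<close> the exponent is 0 - (-1) = 1, hence the value
        -1.\<close>
      then have "aff_dim G = 0" using Gne by (simp add: aff_dim_eq_dim_lin_dir)
      then show ?thesis using GP by (simp add: signed_interior_angle_def interior_angle_def)
    qed (simp add: signed_interior_angle_def interior_angle_def)
    moreover have "z \<noteq> lin_dir G" using True Gne lin_dir_eq_empty_iff[of G] by blast
    ultimately show ?thesis by simp
  qed
  finally show ?thesis .
qed

text \<open>Grouping an upper sum by flats shows that the fibre sums satisfy the equations
  characterising the Moebius function.\<close>

lemma signed_interior_angle_fiber_sum:
  fixes P :: "'a::euclidean_space set"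
  assumes P: "belt_polytope P" and \<alpha>: "cone_angle \<alpha>"
    and G: "G \<in> face_lattice P" and q: "q \<in> flats0 P"
  shows "(\<Sum>F \<in> {F \<in> face_lattice P. lin_dir F = q}. signed_interior_angle \<alpha> P F G)
    = moebius_fun (flats0 P) q (lin_dir G)"
proof (rule moebius_fun_unique[OF _ q])
  show fin: "finite (flats0 P)" using finite_face_lattice[OF P] by (simp add: flats0_eq_image)
  show "lin_dir G \<in> flats0 P" using G by (simp add: flats0_eq_image)
  fix z assume z: "z \<in> flats0 P"
  let ?S = "{F. F \<in> face_lattice P \<and> z \<subseteq> lin_dir F}"
  have "(\<Sum>t | t \<in> flats0 P \<and> z \<le> t. \<Sum>F \<in> {F \<in> face_lattice P. lin_dir F = t}. signed_interior_angle \<alpha> P F G)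
      = (\<Sum>t | t \<in> flats0 P \<and> z \<le> t. \<Sum>F \<in> {F \<in> ?S. lin_dir F = t}. signed_interior_angle \<alpha> P F G)"
    by (intro sum.cong) auto
  also have "\<dots> = (\<Sum>F\<in>?S. signed_interior_angle \<alpha> P F G)"
    using fin finite_face_lattice[OF P] by (intro sum.group) (auto simp: flats0_eq_image)
  also have "\<dots> = (if z = lin_dir G then 1 else 0)"
    using G by (intro signed_interior_angle_upper_sum[OF P \<alpha> _ z]) (simp add: face_lattice_def)
  finally show "(\<Sum>t | t \<in> flats0 P \<and> z \<le> t. \<Sum>F \<in> {F \<in> face_lattice P. lin_dir F = t}. signed_interior_angle \<alpha> P F G)
      = (if z = lin_dir G then 1 else 0)" .
qed

text \<open>Dimension depends only on the flat, so the sign is constant along a fibre and can be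
  removed. Here \<open>d\<close> gives the empty flat dimension -1, in agreement with
  \<open>aff_dim\<close>.\<close>

lemma interior_angle_fiber_sum:
  fixes P :: "'a::euclidean_space set"
  assumes P: "belt_polytope P" and \<alpha>: "cone_angle \<alpha>"
    and G: "G \<in> face_lattice P" and q: "q \<in> flats0 P"
  defines "d \<equiv> \<lambda>q :: 'a set. if q = {} then - 1 else int (dim q)"
  shows "(\<Sum>F \<in> {F \<in> face_lattice P. lin_dir F = q}. interior_angle \<alpha> P F G)
    = (-1) powi (d (lin_dir G) - d q) * moebius_fun (flats0 P) q (lin_dir G)"
proof -
  have d: "aff_dim F = d (lin_dir F)" for F :: "'a set"
    by (simp add: d_def lin_dir_eq_empty_iff aff_dim_eq_dim_lin_dir)
  have inv: "(-1 :: real) powi n * ((-1) powi n * x) = x" for n x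
    by (simp add: power_int_mult_distrib flip: mult.assoc power_int_mult_distrib)
  have "interior_angle \<alpha> P F G = (-1) powi (d (lin_dir G) - d q) * signed_interior_angle \<alpha> P F G"
    if "lin_dir F = q" for F
    using that by (simp add: signed_interior_angle_def d inv)
  then show ?thesis
    by (simp add: signed_interior_angle_fiber_sum[OF P \<alpha> G q, symmetric] sum_distrib_left)
qed

theorem theorem4p5:
  fixes P :: "'a::euclidean_space set"
    and \<alpha> :: "'a set \<Rightarrow> real"
  assumes "belt_polytope P"
    and "cone_angle \<alpha>"
  shows "interior_angle \<alpha> P \<in> compatible_incidence_algebra (face_lattice P) (flats0 P) lin_dir
       \<and> exterior_angle \<alpha> P \<in> compatible_incidence_algebra (face_lattice P) (flats0 P) lin_dir
       \<and> pushforward (face_lattice P) lin_dir (exterior_angle \<alpha> P) = zeta_fun (flats0 P)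
       \<and> pushforward (face_lattice P) lin_dir (signed_interior_angle \<alpha> P) = moebius_fun (flats0 P)"
proof (intro conjI)
  have "interior_angle \<alpha> P \<in> incidence_algebra (face_lattice P)"
    by (auto simp: incidence_algebra_def interior_angle_def face_lattice_def)
  then show "interior_angle \<alpha> P \<in> compatible_incidence_algebra (face_lattice P) (flats0 P) lin_dir"
    using interior_angle_fiber_sum[OF assms] by (rule compatible_if_fiber_sums)
  have "exterior_angle \<alpha> P \<in> incidence_algebra (face_lattice P)"
    by (auto simp: incidence_algebra_def exterior_angle_def face_lattice_def)
  then show "exterior_angle \<alpha> P \<in> compatible_incidence_algebra (face_lattice P) (flats0 P) lin_dir"
    using exterior_angle_fiber_sum[OF assms] by (rule compatible_if_fiber_sums)
  show "pushforward (face_lattice P) lin_dir (exterior_angle \<alpha> P) = zeta_fun (flats0 P)"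
    using finite_face_lattice[OF assms(1)] flats0_eq_image exterior_angle_fiber_sum[OF assms]
    by (rule pushforward_if_fiber_sums) (auto simp: zeta_fun_def)
  show "pushforward (face_lattice P) lin_dir (signed_interior_angle \<alpha> P) = moebius_fun (flats0 P)"
    using finite_face_lattice[OF assms(1)] flats0_eq_image signed_interior_angle_fiber_sum[OF assms] moebius_fun_eq_0
    by (rule pushforward_if_fiber_sums)
qed

end
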